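(* For the free-infinitely divisible Voiculescu transform $$V_{\tilde C}(iw)=-F_{\tilde C}(iw)=i\Big[1-w\,\beta\Big(\frac{w}{2}\Big)\Big],\qquad w>0,$$ the characteristics are given by $a_{\tilde C}=b_{\tilde C}=0$, and the measure $\rho_{\tilde C}$ is such that $\rho_{\tilde C}(\mathbb{R})=\frac{\pi}{2}-1$ and, for all $s\in\mathbb{R}$, $$\mathfrak{F}[\rho_{\tilde C}\,;\,s]=2\sinh(s)\arctan(e^{-s})+\frac{\pi}{2}e^{-s}-1=\int_0^\infty\cos(sx)\,\frac{x}{(1+x^2)\sinh\left(\frac{\pi}{2}x\right)}\,dx.$$
   Context: The function $\beta$ is $\beta(z)=\int_0^\infty e^{-zx}\frac{dx}{1+e^{-x}}$, $\Re(z)>0$. The characteristics $(a_X,b_X,\rho_X)$ of $F_X$ are the unique $a_X\in\mathbb{R}$, $b_X\ge0$ and finite non-negative Borel measure $\rho_X$ on $\mathbb{R}$ such that $$F_X(iw)=a_X+i\,b_X\,w+\int_{\mathbb{R}}\frac{iwx-1}{iw+x}\,\rho_X(dx),\qquad w>0.$$ Here $V_X=-F_X$, and $\mathfrak{F}[\rho\,;\,s]=\int_{\mathbb{R}}e^{isx}\rho(dx)$. The label $\tilde C$ refers to the free-probability analog of the random variable $C$ with characteristic function $1/\cosh(s)$; the function $F_{\tilde C}$ is the one explicitly given in the claim. *)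

theory Defs
  imports "HOL-Probability.Probability"
begin

definition nielsen_beta :: "complex \<Rightarrow> complex" where
  "nielsen_beta z =
     (LINT x:{0<..}|lborel. exp (- z * complex_of_real x) / (1 + exp (- complex_of_real x)))"

(* For w > 0 the integrand is bounded and continuous in x (the denominator never vanishes on the
   real line), so it is integrable against every finite Borel measure. *)
definition free_id_representation ::
  "(complex \<Rightarrow> complex) \<Rightarrow> real \<Rightarrow> real \<Rightarrow> real measure \<Rightarrow> bool" where
  "free_id_representation F a b \<rho> \<longleftrightarrow>
     0 \<le> b \<and> finite_measure \<rho> \<and> sets \<rho> = sets borel \<and>
     (\<forall>w::real. w > 0 \<longrightarrow>
        F (\<i> * of_real w) = of_real a + \<i> * of_real b * of_real w +
          (LINT x|\<rho>. (\<i> * of_real w * of_real x - 1) / (\<i> * of_real w + of_real x)))"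

(* Uniqueness is part of the notion: the characteristics are the unique representing triple. *)
definition free_characteristics ::
  "(complex \<Rightarrow> complex) \<Rightarrow> real \<Rightarrow> real \<Rightarrow> real measure \<Rightarrow> bool" where
  "free_characteristics F a b \<rho> \<longleftrightarrow>
     free_id_representation F a b \<rho> \<and>
     (\<forall>a' b' \<rho>'. free_id_representation F a' b' \<rho>' \<longrightarrow> a' = a \<and> b' = b \<and> \<rho>' = \<rho>)"

end

theory Submission
  imports Defs "HOL-Real_Asymp.Real_Asymp"
begin

text \<open>
  The measure is the even one with density \<open>k x / (2 (1 + x\<^sup>2))\<close>, where
  \<open>k x = x / sinh (pi x / 2)\<close>. Everything about it comes from one transform pair: the cosine
  transform of \<open>k\<close> over the half-line is \<open>1 / (cosh t)\<^sup>2\<close> (lemma \<open>cos_transform_sinh_kernel\<close>). To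
  see this, expand \<open>1 / sinh\<close> into a geometric series of exponentials and integrate term by term.
  The result is the partial fraction expansion of \<open>1 / (cosh t)\<^sup>2\<close>, which is the reflection
  formula for the trigamma function on the line with real part 1/2.

  Writing \<open>w / (w\<^sup>2 + x\<^sup>2)\<close> as the integral of \<open>exp (- w u) cos (u x)\<close> over \<open>u > 0\<close> and exchanging
  integrals (lemma \<open>cos_transform_sinh_kernel_poisson\<close>) expresses the integral of
  \<open>cos (s x) k x w / (w\<^sup>2 + x\<^sup>2)\<close> through \<open>exp (- w u) / (cosh (s \<plusminus> u))\<^sup>2\<close>. For \<open>w = 1\<close> the
  latter has an elementary antiderivative, and the characteristic function and the total mass
  result. For \<open>s = 0\<close> one obtains the integral of \<open>exp (- w u) / (cosh u)\<^sup>2\<close>, which an integration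
  by parts identifies with \<open>w \<beta>(w / 2) - 1\<close>; as the Nevanlinna kernel \<open>(i w x - 1) / (i w + x)\<close>
  has even part \<open>i w (1 + x\<^sup>2) / (w\<^sup>2 + x\<^sup>2)\<close> in \<open>x\<close>, this is the required representation of \<open>F\<close>
  with \<open>a = b = 0\<close>.

  The values of \<open>F\<close> on the positive imaginary axis determine the triple (lemma
  \<open>free_id_representation_unique\<close>): up to elementary terms and factors, \<open>F (i w)\<close> is the Laplace
  transform at \<open>w\<close> of the characteristic function of the measure, and both transforms are
  injective.
\<close>

section \<open>Integrals over the half-line\<close>

lemma set_integrable_exp_decay:
  assumes "c > 0"
  shows "set_integrable lborel {0<..} (\<lambda>x::real. exp (- (c * x)))"
proof -
  have "set_integrable lborel (einterval 0 \<infinity>) (\<lambda>x::real. exp (- (c * x)))"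
  proof (rule interval_integral_FTC_nonneg(1)[where F = "\<lambda>x. - exp (- (c * x)) / c"])
    show "(((\<lambda>x. - exp (- (c * x)) / c) \<circ> real_of_ereal) \<longlongrightarrow> - 1 / c) (at_right 0)"
      unfolding zero_ereal_def ereal_tendsto_simps
      by (rule tendsto_eq_intros refl | use assms in simp)+
    have "((\<lambda>x. - exp (- (c * x)) / c) \<longlongrightarrow> 0) at_top"
      using assms by real_asymp
    then show "(((\<lambda>x. - exp (- (c * x)) / c) \<circ> real_of_ereal) \<longlongrightarrow> 0) (at_left \<infinity>)"
      unfolding ereal_tendsto_simps .
  qed (use assms in \<open>auto intro!: derivative_eq_intros\<close>)
  then show ?thesis by (simp add: zero_ereal_def)
qed

text \<open>
  Every integrand over the half-line below decays exponentially, so this is the integrability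
  criterion used throughout.
\<close>

lemma set_integrable_of_exp_bound:
  fixes f :: "real \<Rightarrow> 'a::{banach, second_countable_topology}"
  assumes "c > 0" "set_borel_measurable lborel {0<..} f"
    and "\<And>x. x > 0 \<Longrightarrow> norm (f x) \<le> C * exp (- (c * x))"
  shows "set_integrable lborel {0<..} f"
proof (rule set_integrable_bound)
  show "set_integrable lborel {0<..} (\<lambda>x. C * exp (- (c * x)))"
    using set_integrable_exp_decay[OF \<open>c > 0\<close>] by simp
  show "AE x in lborel. x \<in> {0<..} \<longrightarrow> norm (f x) \<le> norm (C * exp (- (c * x)))"
    using assms(3) by (auto intro!: AE_I2 order_trans[OF _ abs_ge_self])
qed fact

lemma set_integral_half_line_FTC:
  fixes f F :: "real \<Rightarrow> 'a::euclidean_space"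
  assumes F: "\<And>x. x > 0 \<Longrightarrow> (F has_vector_derivative f x) (at x)"
    and f: "\<And>x. x > 0 \<Longrightarrow> isCont f x"
    and int: "set_integrable lborel {0<..} f"
    and A: "(F \<longlongrightarrow> A) (at_right 0)" and B: "(F \<longlongrightarrow> B) at_top"
  shows "(LINT x:{0<..}|lborel. f x) = B - A"
proof -
  have "(LBINT x=0..\<infinity>. f x) = B - A"
  proof (rule interval_integral_FTC_integrable[where F = F])
    show "((F \<circ> real_of_ereal) \<longlongrightarrow> A) (at_right 0)"
      unfolding zero_ereal_def ereal_tendsto_simps by fact
    show "((F \<circ> real_of_ereal) \<longlongrightarrow> B) (at_left \<infinity>)"
      unfolding ereal_tendsto_simps by fact
  qed (use F f int in \<open>auto simp: zero_ereal_def\<close>)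
  then show ?thesis
    by (simp add: zero_ereal_def interval_integral_to_infinity_eq)
qed

lemma tendsto_exp_complex_decay:
  assumes "Re z > 0"
  shows "((\<lambda>x. exp (- (z * complex_of_real x))) \<longlongrightarrow> 0) at_top"
    and "((\<lambda>x. complex_of_real x * exp (- (z * complex_of_real x))) \<longlongrightarrow> 0) at_top"
proof -
  have "((\<lambda>x. exp (- (Re z * x))) \<longlongrightarrow> 0) at_top" "((\<lambda>x. x * exp (- (Re z * x))) \<longlongrightarrow> 0) at_top"
    using assms by real_asymp+
  from this(1) tendsto_rabs_zero[OF this(2)]
  have "((\<lambda>x. norm (exp (- (z * complex_of_real x)))) \<longlongrightarrow> 0) at_top"
    and "((\<lambda>x. norm (complex_of_real x * exp (- (z * complex_of_real x)))) \<longlongrightarrow> 0) at_top"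
    by (simp_all add: norm_mult abs_mult)
  then show "((\<lambda>x. exp (- (z * complex_of_real x))) \<longlongrightarrow> 0) at_top"
    and "((\<lambda>x. complex_of_real x * exp (- (z * complex_of_real x))) \<longlongrightarrow> 0) at_top"
    by (simp_all only: tendsto_norm_zero_iff)
qed

lemma set_integrable_exp_complex:
  assumes "Re z > 0"
  shows "set_integrable lborel {0<..} (\<lambda>x. exp (- (z * complex_of_real x)))"
  by (rule set_integrable_of_exp_bound[where c = "Re z" and C = 1])
     (use assms in \<open>auto simp: set_borel_measurable_def\<close>)

lemma set_integral_exp_complex:
  assumes "Re z > 0"
  shows "(LINT x:{0<..}|lborel. exp (- (z * complex_of_real x))) = 1 / z"
proof -
  have z: "z \<noteq> 0" using assms by auto
  have "(LINT x:{0<..}|lborel. exp (- (z * complex_of_real x))) = 0 - (- 1 / z)"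
  proof (rule set_integral_half_line_FTC[where F = "\<lambda>x. - exp (- (z * complex_of_real x)) / z"])
    show "((\<lambda>x. - exp (- (z * complex_of_real x)) / z) \<longlongrightarrow> 0) at_top"
      using tendsto_divide[OF tendsto_minus[OF tendsto_exp_complex_decay(1)[OF assms]] tendsto_const[of z]] z
      by simp
    show "((\<lambda>x. - exp (- (z * complex_of_real x)) / z) \<longlongrightarrow> - 1 / z) (at_right 0)"
      by (rule tendsto_eq_intros refl | use z in simp)+
  qed (use z assms in \<open>auto intro!: derivative_eq_intros has_vector_derivative_real_field
        set_integrable_exp_complex\<close>)
  then show ?thesis by simp
qed

lemma set_integral_exp_decay:
  fixes c :: real
  assumes "c > 0"
  shows "(LINT x:{0<..}|lborel. exp (- (c * x))) = 1 / c"
proof -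
  have "complex_of_real (LINT x:{0<..}|lborel. exp (- (c * x))) = of_real (1 / c)"
    using set_integral_exp_complex[of "of_real c"] assms
    unfolding set_integral_complex_of_real[symmetric] by (simp add: exp_of_real[symmetric])
  then show ?thesis by (simp only: of_real_eq_iff)
qed

lemma mult_exp_le_exp_half:
  fixes c x :: real
  assumes "c > 0" "x > 0"
  shows "x * exp (- (c * x)) \<le> 2 / c * exp (- (c / 2 * x))"
proof -
  have "x * exp (- (c * x)) = 2 / c * (c / 2 * x) * exp (- (c * x))"
    using assms by (simp add: field_simps)
  also have "\<dots> \<le> 2 / c * exp (c / 2 * x) * exp (- (c * x))"
  proof (intro mult_right_mono mult_left_mono)
    show "c / 2 * x \<le> exp (c / 2 * x)"
      using exp_ge_add_one_self[of "c / 2 * x"] by linarith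
  qed (use assms in auto)
  also have "\<dots> = 2 / c * exp (- (c / 2 * x))"
    by (simp add: mult.assoc flip: exp_add)
  finally show ?thesis .
qed

lemma set_integrable_mult_exp_complex:
  assumes "Re z > 0"
  shows "set_integrable lborel {0<..} (\<lambda>x. complex_of_real x * exp (- (z * complex_of_real x)))"
  by (rule set_integrable_of_exp_bound[where c = "Re z / 2" and C = "2 / Re z"])
     (use assms mult_exp_le_exp_half[of "Re z"] in \<open>auto simp: set_borel_measurable_def norm_mult\<close>)

lemma set_integral_mult_exp_complex:
  assumes "Re z > 0"
  shows "(LINT x:{0<..}|lborel. complex_of_real x * exp (- (z * complex_of_real x))) = 1 / z\<^sup>2"
proof -
  have z: "z \<noteq> 0" using assms by auto
  let ?F = "\<lambda>x. - (complex_of_real x * exp (- (z * complex_of_real x))) / z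
               - exp (- (z * complex_of_real x)) / z\<^sup>2"
  have "(LINT x:{0<..}|lborel. complex_of_real x * exp (- (z * complex_of_real x))) = 0 - (- 1 / z\<^sup>2)"
  proof (rule set_integral_half_line_FTC[where F = ?F])
    show "(?F \<longlongrightarrow> 0) at_top"
      using tendsto_diff[OF
          tendsto_divide[OF tendsto_minus[OF tendsto_exp_complex_decay(2)[OF assms]] tendsto_const[of z]]
          tendsto_divide[OF tendsto_exp_complex_decay(1)[OF assms] tendsto_const[of "z\<^sup>2"]]] z
      by simp
    show "(?F \<longlongrightarrow> - 1 / z\<^sup>2) (at_right 0)"
      by (rule tendsto_eq_intros refl | use z in simp)+
    show "(?F has_vector_derivative complex_of_real x * exp (- (z * complex_of_real x))) (at x)" for x
    proof -
      have "((\<lambda>y. - (y * exp (- (z * y))) / z - exp (- (z * y)) / z\<^sup>2) has_field_derivative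
              complex_of_real x * exp (- (z * complex_of_real x))) (at (complex_of_real x))"
        using z by (auto intro!: derivative_eq_intros simp: field_simps power2_eq_square)
      from has_vector_derivative_real_field[OF this] show ?thesis .
    qed
  qed (use z assms in \<open>auto intro!: set_integrable_mult_exp_complex\<close>)
  then show ?thesis by simp
qed

text \<open>
  Both exchanges of integration below (a measure against the Lebesgue measure, and the Lebesgue
  measure against itself) have an integrand dominated by a product of integrable functions of one
  variable each, which gives joint integrability at once.
\<close>

lemma Fubini_dominated_by_product:
  fixes f :: "'a \<Rightarrow> 'b \<Rightarrow> 'c::{banach, second_countable_topology}"
  assumes "sigma_finite_measure M" "sigma_finite_measure N"
    and f[measurable]: "case_prod f \<in> borel_measurable (M \<Otimes>\<^sub>M N)"
    and a: "integrable M (a :: 'a \<Rightarrow> real)" and b: "integrable N (b :: 'b \<Rightarrow> real)"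
    and bound: "\<And>x y. norm (f x y) \<le> a x * b y"
  shows "(\<integral>y. (\<integral>x. f x y \<partial>M) \<partial>N) = (\<integral>x. (\<integral>y. f x y \<partial>N) \<partial>M)"
proof -
  interpret M: sigma_finite_measure M by fact
  interpret N: sigma_finite_measure N by fact
  interpret pair_sigma_finite M N ..
  have [measurable]: "a \<in> borel_measurable M" "b \<in> borel_measurable N"
    using a b by auto
  have "integrable (M \<Otimes>\<^sub>M N) (\<lambda>(x, y). a x * b y)"
  proof (rule Fubini_integrable)
    have "(\<lambda>x. \<integral>y. norm (case (x, y) of (x, y) \<Rightarrow> a x * b y) \<partial>N) = (\<lambda>x. \<bar>a x\<bar> * (\<integral>y. \<bar>b y\<bar> \<partial>N))"
      by (simp add: abs_mult)
    then show "integrable M (\<lambda>x. \<integral>y. norm (case (x, y) of (x, y) \<Rightarrow> a x * b y) \<partial>N)"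
      using a by simp
  qed (use b in auto)
  then have "integrable (M \<Otimes>\<^sub>M N) (case_prod f)"
    by (rule Bochner_Integration.integrable_bound)
       (auto intro!: AE_I2 order_trans[OF bound abs_ge_self])
  then show ?thesis by (rule Fubini_integral)
qed

section \<open>Injectivity of the Laplace transform\<close>

text \<open>
  Under \<open>u = exp (- t)\<close> the hypothesis says that the function \<open>u \<mapsto> u * g (- ln u)\<close>, which is continuous
  on \<open>[0, 1]\<close> because \<open>g\<close> is bounded, has vanishing moments. By the Weierstrass theorem a
  polynomial in \<open>exp (- t)\<close> approximates \<open>exp (- t) * g t\<close> uniformly. Integrating against
  \<open>exp (- 2 t) * g t\<close>, which annihilates the polynomial, makes the integral of
  \<open>exp (- 3 t) * (g t)\<^sup>2\<close> arbitrarily small. It is therefore zero, and so is \<open>g\<close>. The shift by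
  2 in the exponents leaves room for the factor \<open>u\<close> that forces continuity at \<open>u = 0\<close> and keeps an
  integrable weight.
\<close>

lemma continuous_zero_if_laplace_moments_vanish:
  fixes g :: "real \<Rightarrow> real"
  assumes cont: "continuous_on UNIV g" and bound: "\<And>t. \<bar>g t\<bar> \<le> M"
    and moments: "\<And>n::nat. (LINT t:{0<..}|lborel. exp (- ((real n + 2) * t)) * g t) = 0"
    and "t \<ge> 0"
  shows "g t = 0"
proof -
  have [measurable]: "g \<in> borel_measurable borel"
    using cont by (rule borel_measurable_continuous_onI)
  have M: "M \<ge> 0" using bound[of 0] by linarith
  have int: "set_integrable lborel {0<..} (\<lambda>t. exp (- (c * t)) * (h t * g t))"
    if "c > 0" "h \<in> borel_measurable borel" "\<And>t. t > 0 \<Longrightarrow> \<bar>h t\<bar> \<le> C" for c C :: real and h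
  proof (rule set_integrable_of_exp_bound[where c = c and C = "C * M"])
    note [measurable] = that(2)
    show "set_borel_measurable lborel {0<..} (\<lambda>t. exp (- (c * t)) * (h t * g t))"
      unfolding set_borel_measurable_def by measurable
    fix x :: real assume x: "x > 0"
    have "\<bar>h x\<bar> * \<bar>g x\<bar> \<le> C * M"
      using that(3)[OF x] bound[of x] by (intro mult_mono) (auto intro: order_trans[OF abs_ge_zero])
    then show "norm (exp (- (c * x)) * (h x * g x)) \<le> C * M * exp (- (c * x))"
      by (simp add: abs_mult)
  qed fact
  \<comment> \<open>The function to be approximated on \<open>[0, 1]\<close>, in the variable \<open>u = exp (- t)\<close>.\<close>
  define k where "k u = (if u \<le> 0 then 0 else u * g (- ln u))" for u
  have k: "continuous_on {0..1} k"
    unfolding continuous_on_eq_continuous_within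
  proof
    fix u :: real assume u: "u \<in> {0..1}"
    show "continuous (at u within {0..1}) k"
    proof (cases "u = 0")
      case True
      have "(k \<longlongrightarrow> 0) (at 0)"
      proof (rule Lim_null_comparison)
        have "\<bar>k u\<bar> \<le> M * \<bar>u\<bar>" for u
          using bound[of "- ln u"] M
          by (auto simp: k_def abs_mult mult.commute mult_right_mono mult_nonneg_nonpos)
        then show "\<forall>\<^sub>F u in at 0. norm (k u) \<le> M * \<bar>u\<bar>" by simp
        show "((\<lambda>u. M * \<bar>u\<bar>) \<longlongrightarrow> 0) (at (0::real))"
          by (rule tendsto_eq_intros refl | simp)+
      qed
      then show ?thesis
        using True tendsto_within_subset[where S = UNIV and T = "{0..1}"]
        by (simp add: continuous_within k_def)
    next
      case False
      then have "u > 0" using u by simp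
      have "isCont g (- ln u)"
        using cont by (auto simp: continuous_on_eq_continuous_at)
      moreover have "isCont (\<lambda>u. - ln u) u"
        using \<open>u > 0\<close> by (auto intro!: continuous_intros)
      ultimately have "isCont (\<lambda>u. g (- ln u)) u"
        using isCont_o2 by blast
      then have "isCont (\<lambda>u. u * g (- ln u)) u"
        by (auto intro!: continuous_mult)
      moreover have "eventually (\<lambda>v. k v = v * g (- ln v)) (nhds u)"
        using eventually_nhds_in_open[of "{0<..}" u] \<open>u > 0\<close>
        by (auto simp: k_def elim!: eventually_mono)
      ultimately have "isCont k u"
        using isCont_cong[of k "\<lambda>u. u * g (- ln u)" u] by simp
      then show ?thesis by (rule continuous_at_imp_continuous_at_within)
    qed
  qed
  let ?I = "LINT t:{0<..}|lborel. exp (- (3 * t)) * (g t)\<^sup>2"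
  have approx: "\<bar>?I\<bar> \<le> e * M / 2" if "e > 0" for e
  proof -
    obtain P where "real_polynomial_function P" and P: "\<And>u. u \<in> {0..1} \<Longrightarrow> \<bar>k u - P u\<bar> < e"
      using Stone_Weierstrass_real_polynomial_function[OF compact_Icc k \<open>e > 0\<close>] by blast
    then obtain a n where Pa: "P = (\<lambda>u. \<Sum>i\<le>n. a i * u ^ i)"
      using real_polynomial_function_imp_sum[of P] by auto
    \<comment> \<open>Against this weight each monomial of \<open>P\<close> becomes one of the vanishing moments.\<close>
    have P_exp: "exp (- (2 * t)) * (P (exp (- t)) * g t)
        = (\<Sum>i\<le>n. a i * (exp (- ((real i + 2) * t)) * g t))" for t
    proof -
      have "exp (- ((real i + 2) * t)) = exp (- (2 * t)) * exp (- t) ^ i" for i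
        by (simp add: exp_of_nat_mult[symmetric] exp_add[symmetric] algebra_simps)
      then show ?thesis
        by (simp add: Pa sum_distrib_left sum_distrib_right mult_ac)
    qed
    have "(LINT t:{0<..}|lborel. exp (- (2 * t)) * (P (exp (- t)) * g t)) =
        (\<Sum>i\<le>n. (LINT t:{0<..}|lborel. a i * (exp (- ((real i + 2) * t)) * g t)))"
      unfolding P_exp set_lebesgue_integral_def scaleR_sum_right
    proof (rule Bochner_Integration.integral_sum)
      fix i
      show "integrable lborel (\<lambda>t. indicator {0<..} t *\<^sub>R (a i * (exp (- ((real i + 2) * t)) * g t)))"
        using int[of "real i + 2" "\<lambda>_. 1" 1] unfolding set_integrable_def
        by (auto simp: algebra_simps dest: integrable_mult_right[of "a i"])
    qed
    also have "\<dots> = 0" using moments by simp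
    finally have P0: "(LINT t:{0<..}|lborel. exp (- (2 * t)) * (P (exp (- t)) * g t)) = 0" .
    have Pc: "continuous_on UNIV P" unfolding Pa by (intro continuous_intros)
    have [measurable]: "P \<in> borel_measurable borel"
      using Pc by (rule borel_measurable_continuous_onI)
    have Pb: "\<bar>P (exp (- t))\<bar> \<le> M + e" if "t > 0" for t
    proof -
      have "\<bar>k (exp (- t))\<bar> \<le> 1 * M"
        unfolding k_def using bound[of t] that M mult_mono[of "exp (- t)" 1 "\<bar>g t\<bar>" M]
        by (auto simp: abs_mult)
      then show ?thesis using P[of "exp (- t)"] that by auto
    qed
    have "exp (- (3 * t)) * (g t)\<^sup>2 = exp (- (2 * t)) * (exp (- t) * g t * g t)" for t
    proof -
      have "exp (- (3 * t)) = exp (- (2 * t)) * exp (- t)"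
        by (simp flip: exp_add)
      then show ?thesis by (simp add: power2_eq_square)
    qed
    then have "?I = (LINT t:{0<..}|lborel. exp (- (2 * t)) * (exp (- t) * g t * g t))"
      by simp
    also have "\<dots> = (LINT t:{0<..}|lborel. exp (- (2 * t)) * (exp (- t) * g t * g t)) -
        (LINT t:{0<..}|lborel. exp (- (2 * t)) * (P (exp (- t)) * g t))"
      by (simp add: P0)
    also have "\<dots> = (LINT t:{0<..}|lborel. exp (- (2 * t)) * (exp (- t) * g t * g t) -
        exp (- (2 * t)) * (P (exp (- t)) * g t))"
    proof (intro set_integral_diff(2)[symmetric] int)
      show "\<bar>exp (- t) * g t\<bar> \<le> 1 * M" if "t > 0" for t
        using bound[of t] that mult_mono[of "exp (- t)" 1 "\<bar>g t\<bar>" M] by (simp add: abs_mult)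
    qed (use Pb in auto)
    finally have I: "?I = (LINT t:{0<..}|lborel. exp (- (2 * t)) * (exp (- t) * g t * g t) -
        exp (- (2 * t)) * (P (exp (- t)) * g t))" .
    have diff: "exp (- (2 * t)) * (exp (- t) * g t * g t) - exp (- (2 * t)) * (P (exp (- t)) * g t)
          = exp (- (2 * t)) * ((exp (- t) * g t - P (exp (- t))) * g t)" for t
      by (simp add: algebra_simps)
    have close: "\<bar>exp (- t) * g t - P (exp (- t))\<bar> \<le> e" if "t > 0" for t
      using P[of "exp (- t)"] that by (simp add: k_def)
    have "norm (LINT t|lborel. indicator {0<..} t *\<^sub>R (exp (- (2 * t)) * ((exp (- t) * g t - P (exp (- t))) * g t)))
        \<le> (LINT t|lborel. indicator {0<..} t *\<^sub>R (e * M * exp (- (2 * t))))"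
    proof (rule Bochner_Integration.integral_norm_bound_integral)
      show "integrable lborel (\<lambda>t. indicator {0<..} t *\<^sub>R (exp (- (2 * t)) * ((exp (- t) * g t - P (exp (- t))) * g t)))"
        using int[of 2 "\<lambda>t. exp (- t) * g t - P (exp (- t))" e] close unfolding set_integrable_def by simp
      show "integrable lborel (\<lambda>t. indicator {0<..} t *\<^sub>R (e * M * exp (- (2 * t))))"
        using set_integrable_exp_decay[of 2] unfolding set_integrable_def[symmetric] by simp
      fix t
      show "norm (indicator {0<..} t *\<^sub>R (exp (- (2 * t)) * ((exp (- t) * g t - P (exp (- t))) * g t)))
          \<le> indicator {0<..} t *\<^sub>R (e * M * exp (- (2 * t)))"
      proof (cases "t > 0")
        case True
        have "\<bar>exp (- t) * g t - P (exp (- t))\<bar> * \<bar>g t\<bar> \<le> e * M"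
          using close[OF True] bound[of t] \<open>e > 0\<close> by (intro mult_mono) auto
        then show ?thesis using True by (simp add: abs_mult mult.commute)
      qed auto
    qed
    also have "(LINT t|lborel. indicator {0<..} t *\<^sub>R (exp (- (2 * t)) * ((exp (- t) * g t - P (exp (- t))) * g t))) = ?I"
      using I unfolding diff set_lebesgue_integral_def by simp
    also have "(LINT t|lborel. indicator {0<..} t *\<^sub>R (e * M * exp (- (2 * t)))) = e * M / 2"
      using set_integral_exp_decay[of 2] unfolding set_lebesgue_integral_def[symmetric] by simp
    finally show ?thesis by simp
  qed
  have "?I = 0"
  proof -
    \<comment> \<open>The tolerance is \<open>2 e / (M + 1)\<close> because \<open>M\<close> may be 0.\<close>
    have "\<bar>?I\<bar> \<le> 0 + e" if "e > 0" for e
    proof -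
      have "\<bar>?I\<bar> \<le> 2 * e / (M + 1) * M / 2"
        using approx[of "2 * e / (M + 1)"] that M by simp
      also have "\<dots> \<le> e" using M that by (simp add: field_simps)
      finally show ?thesis by simp
    qed
    then show ?thesis using field_le_epsilon[of "\<bar>?I\<bar>" 0] by simp
  qed
  moreover have "integrable lborel (\<lambda>t. indicator {0<..} t *\<^sub>R (exp (- (3 * t)) * (g t)\<^sup>2))"
    using int[of 3 g M] bound unfolding set_integrable_def by (simp add: power2_eq_square)
  ultimately have "AE t in lborel. indicator {0<..} t *\<^sub>R (exp (- (3 * t)) * (g t)\<^sup>2) = 0"
    unfolding set_lebesgue_integral_def by (subst (asm) integral_nonneg_eq_0_iff_AE) auto
  then have AE: "AE t\<in>{0<..} in lebesgue. t \<in> {t. g t = 0}"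
    by (intro AE_completion) (auto elim!: eventually_mono split: split_indicator)
  have closed: "closed {t. g t = 0}"
    using cont by (intro closed_Collect_eq) auto
  have "{0<..} \<subseteq> {t. g t = 0}"
    using mem_closed_if_AE_lebesgue_open[OF open_greaterThan closed AE] by blast
  then have "closure {0<..} \<subseteq> {t. g t = 0}"
    using closed by (rule closure_minimal)
  then show ?thesis using \<open>t \<ge> 0\<close> by auto
qed

lemma complex_continuous_zero_if_laplace_moments_vanish:
  fixes g :: "real \<Rightarrow> complex"
  assumes cont: "continuous_on UNIV g" and bound: "\<And>t. norm (g t) \<le> M"
    and moments: "\<And>n::nat. (LINT t:{0<..}|lborel. of_real (exp (- ((real n + 2) * t))) * g t) = 0"
    and "t \<ge> 0"
  shows "g t = 0"
proof -
  have [measurable]: "g \<in> borel_measurable borel"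
    using cont by (rule borel_measurable_continuous_onI)
  have int: "set_integrable lborel {0<..} (\<lambda>t. of_real (exp (- ((real n + 2) * t))) * g t)" for n :: nat
  proof (rule set_integrable_of_exp_bound[where c = "real n + 2" and C = M])
    show "norm (of_real (exp (- ((real n + 2) * x))) * g x) \<le> M * exp (- ((real n + 2) * x))" for x
      using bound[of x] by (simp add: norm_mult)
  qed (auto simp: set_borel_measurable_def)
  have "Re (g t) = 0"
  proof (rule continuous_zero_if_laplace_moments_vanish[where M = M and g = "\<lambda>t. Re (g t)"])
    show "(LINT t:{0<..}|lborel. exp (- ((real n + 2) * t)) * Re (g t)) = 0" for n
      using arg_cong[OF moments[of n], of Re] int[of n]
      unfolding set_lebesgue_integral_def set_integrable_def by (subst (asm) integral_Re[symmetric]) auto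
    show "\<bar>Re (g t)\<bar> \<le> M" for t
      using abs_Re_le_cmod[of "g t"] bound[of t] by linarith
  qed (use cont \<open>t \<ge> 0\<close> in \<open>auto intro: continuous_on_Re\<close>)
  moreover have "Im (g t) = 0"
  proof (rule continuous_zero_if_laplace_moments_vanish[where M = M and g = "\<lambda>t. Im (g t)"])
    show "(LINT t:{0<..}|lborel. exp (- ((real n + 2) * t)) * Im (g t)) = 0" for n
      using arg_cong[OF moments[of n], of Im] int[of n]
      unfolding set_lebesgue_integral_def set_integrable_def by (subst (asm) integral_Im[symmetric]) auto
    show "\<bar>Im (g t)\<bar> \<le> M" for t
      using abs_Im_le_cmod[of "g t"] bound[of t] by linarith
  qed (use cont \<open>t \<ge> 0\<close> in \<open>auto intro: continuous_on_Im\<close>)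
  ultimately show ?thesis by (simp add: complex_eq_iff)
qed

section \<open>Characteristic functions of finite measures\<close>

context finite_borel_measure
begin

declare M_is_borel [simp, measurable_cong]

lemma space_UNIV [simp]: "space M = UNIV"
  using M_is_borel[THEN sets_eq_imp_space_eq] by simp

lemma norm_char_le: "norm (char M t) \<le> measure M UNIV"
proof -
  have "norm (char M t) \<le> (LINT x|M. 1)"
    unfolding char_def by (rule Bochner_Integration.integral_norm_bound_integral) (auto intro!: integrable_const_bound[where B = 1])
  then show ?thesis by simp
qed

lemma char_at_zero: "char M 0 = of_real (measure M UNIV)"
  unfolding char_def by (simp add: scaleR_conv_of_real)

lemma isCont_char_finite: "isCont (char M) t"
  unfolding continuous_at_sequentially
proof safe
  fix X assume X: "X \<longlonglongrightarrow> t"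
  show "(char M \<circ> X) \<longlonglongrightarrow> char M t"
    unfolding comp_def char_def
    by (rule integral_dominated_convergence[where w="\<lambda>_. 1"]) (auto intro!: tendsto_intros X)
qed

lemma char_minus: "char M (- t) = cnj (char M t)"
proof -
  have "integrable M (\<lambda>x. iexp (t * x))"
    by (rule integrable_const_bound[where B = 1]) auto
  then have "cnj (char M t) = (CLINT x|M. cnj (iexp (t * x)))"
    unfolding char_def by (simp only: Bochner_Integration.integral_cnj)
  then show ?thesis by (simp add: char_def exp_cnj)
qed

text \<open>
  Since \<open>1 / (w - i x)\<close> is the Laplace transform of \<open>t \<mapsto> exp (i t x)\<close>, integrating over \<open>x\<close> first
  or last identifies the Cauchy transform of a measure on the imaginary axis with the Laplace
  transform of its characteristic function.
\<close>

lemma laplace_char: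
  assumes "w > 0"
  shows "(LINT t:{0<..}|lborel. of_real (exp (- (w * t))) * char M t)
    = (LINT x|M. 1 / (of_real w - \<i> * of_real x))"
proof -
  have "(LINT t:{0<..}|lborel. of_real (exp (- (w * t))) * char M t)
      = (LINT t|lborel. (LINT x|M. indicator {0<..} t *\<^sub>R (of_real (exp (- (w * t))) * iexp (t * x))))"
    unfolding set_lebesgue_integral_def char_def by simp
  also have "\<dots> = (LINT x|M. (LINT t|lborel. indicator {0<..} t *\<^sub>R (of_real (exp (- (w * t))) * iexp (t * x))))"
  proof (rule Fubini_dominated_by_product[where a = "\<lambda>_. 1" and b = "\<lambda>t. indicator {0<..} t *\<^sub>R exp (- (w * t))"])
    show "integrable lborel (\<lambda>t. indicator {0<..} t *\<^sub>R exp (- (w * t)))"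
      using set_integrable_exp_decay[OF assms] by (simp add: set_integrable_def)
  qed (auto simp: norm_mult sigma_finite_measure_axioms lborel.sigma_finite_measure_axioms)
  also have "\<dots> = (LINT x|M. 1 / (of_real w - \<i> * of_real x))"
  proof (rule Bochner_Integration.integral_cong[OF refl])
    fix x
    have "of_real (exp (- (w * t))) * iexp (t * x) = exp (- ((of_real w - \<i> * of_real x) * of_real t))" for t
      by (simp add: exp_of_real[symmetric] exp_add[symmetric] algebra_simps)
    then show "(LINT t|lborel. indicator {0<..} t *\<^sub>R (of_real (exp (- (w * t))) * iexp (t * x)))
        = 1 / (of_real w - \<i> * of_real x)"
      using set_integral_exp_complex[of "of_real w - \<i> * of_real x"] assms
      by (simp add: set_lebesgue_integral_def)
  qed
  finally show ?thesis .
qed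

end

text \<open>
  Equal characteristic functions have equal values at 0, hence equal total masses; dividing by the
  common mass reduces the claim to Levy's theorem for probability measures, unless the mass is
  zero.
\<close>

lemma finite_measure_eq_if_char_eq:
  assumes "finite_borel_measure M" "finite_borel_measure N" and char: "char M = char N"
  shows "M = N"
proof -
  interpret M: finite_borel_measure M by fact
  interpret N: finite_borel_measure N by fact
  define m where "m = measure M UNIV"
  have m: "measure M UNIV = m" "measure N UNIV = m"
    using fun_cong[OF char, of 0] by (simp_all add: M.char_at_zero N.char_at_zero m_def)
  have em: "emeasure M UNIV = ennreal m" "emeasure N UNIV = ennreal m"
    using m by (simp_all add: M.emeasure_eq_measure N.emeasure_eq_measure)
  show ?thesis
  proof (cases "m = 0")
    case True
    have "emeasure M A = emeasure N A" for A
      using emeasure_space[of M A] emeasure_space[of N A] True em by simp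
    then show ?thesis by (intro measure_eqI) auto
  next
    case False
    then have "m > 0" using m(1) by (metis measure_nonneg order_le_less)
    let ?D = "\<lambda>M. density M (\<lambda>_. ennreal (1 / m))"
    have "?D M = ?D N"
    proof (rule Levy_uniqueness)
      show "real_distribution (?D M)" "real_distribution (?D N)"
        using em \<open>m > 0\<close>
        by (auto intro!: real_distribution.intro real_distribution_axioms.intro prob_spaceI
            simp: emeasure_density_const ennreal_mult[symmetric])
      have "char (?D M) t = char (?D N) t" for t
        using fun_cong[OF char, of t] \<open>m > 0\<close> unfolding char_def by (simp add: integral_density)
      then show "char (?D M) = char (?D N)" by auto
    qed
    then have "ennreal (1 / m) * emeasure M A = ennreal (1 / m) * emeasure N A" if "A \<in> sets borel" for A
      using that by (metis emeasure_density_const M.M_is_borel N.M_is_borel)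
    then have "emeasure M A = emeasure N A" if "A \<in> sets borel" for A
      using that \<open>m > 0\<close> by (auto simp: ennreal_mult_cancel_left)
    then show ?thesis by (intro measure_eqI) auto
  qed
qed

section \<open>Uniqueness of the characteristics\<close>

text \<open>
  The kernel splits as
  \<open>(i w x - 1) / (i w + x) = i w - i (w\<^sup>2 - 1) / (w - i x)\<close>.
  The first summand contributes only the total mass of the measure, the second one the Laplace
  transform of its characteristic function.
\<close>

lemma free_id_representation_via_laplace_char:
  assumes "free_id_representation F a b \<rho>" "w > 0"
  shows "F (\<i> * of_real w) = of_real a + \<i> * of_real ((b + measure \<rho> UNIV) * w)
     - \<i> * of_real (w\<^sup>2 - 1) * (LINT t:{0<..}|lborel. of_real (exp (- (w * t))) * char \<rho> t)"
proof -
  interpret finite_borel_measure \<rho>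
    using assms(1) by (auto simp: free_id_representation_def finite_borel_measure_def finite_borel_measure_axioms_def)
  have kernel: "(\<i> * of_real w * of_real x - 1) / (\<i> * of_real w + of_real x)
      = \<i> * of_real w - \<i> * of_real (w\<^sup>2 - 1) * (1 / (of_real w - \<i> * of_real x))" for x
  proof -
    have nz: "of_real w - \<i> * of_real x \<noteq> 0" using assms(2) by (auto simp: complex_eq_iff)
    have "\<i> * of_real w + of_real x = \<i> * (of_real w - \<i> * of_real x)"
      by (simp add: algebra_simps)
    then show ?thesis using nz
      by (simp add: divide_simps) (simp add: algebra_simps power2_eq_square)
  qed
  have "integrable \<rho> (\<lambda>x. 1 / (of_real w - \<i> * of_real x))"
  proof (rule integrable_const_bound[where B = "1 / w"])
    have "w \<le> norm (of_real w - \<i> * of_real x)" for x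
      using complex_Re_le_cmod[of "of_real w - \<i> * of_real x"] by simp
    then have "norm (1 / (of_real w - \<i> * of_real x)) \<le> 1 / w" for x
      using assms(2) by (simp add: norm_divide frac_le)
    then show "AE x in \<rho>. norm (1 / (of_real w - \<i> * of_real x)) \<le> 1 / w" by auto
  qed auto
  then have int: "integrable \<rho> (\<lambda>x. \<i> * of_real (w\<^sup>2 - 1) * (1 / (of_real w - \<i> * of_real x)))"
    by (rule integrable_mult_right)
  have "(LINT x|\<rho>. (\<i> * of_real w * of_real x - 1) / (\<i> * of_real w + of_real x))
      = \<i> * of_real w * of_real (measure \<rho> UNIV) - \<i> * of_real (w\<^sup>2 - 1) *
        (LINT t:{0<..}|lborel. of_real (exp (- (w * t))) * char \<rho> t)"
    unfolding kernel laplace_char[OF assms(2)]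
    using Bochner_Integration.integral_diff[OF integrable_const int, of "\<i> * of_real w"]
    by (simp only: integral_mult_right_zero) (simp add: scaleR_conv_of_real mult_ac)
  then show ?thesis
    using assms unfolding free_id_representation_def by (simp add: algebra_simps)
qed

text \<open>
  At \<open>w = 1\<close> the Laplace term of the previous lemma vanishes, so the value there determines \<open>a\<close> and
  the sum of \<open>b\<close> and the total mass. For \<open>w > 1\<close> the Laplace transform of the characteristic
  function can then be recovered, which determines the measure. Its total mass finally separates
  \<open>b\<close> from the sum.
\<close>

lemma free_id_representation_unique:
  assumes rep: "free_id_representation F a b \<rho>" and rep': "free_id_representation F a' b' \<rho>'"
  shows "a' = a \<and> b' = b \<and> \<rho>' = \<rho>"
proof -
  interpret \<rho>: finite_borel_measure \<rho>
    using rep by (auto simp: free_id_representation_def finite_borel_measure_def finite_borel_measure_axioms_def)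
  interpret \<rho>': finite_borel_measure \<rho>'
    using rep' by (auto simp: free_id_representation_def finite_borel_measure_def finite_borel_measure_axioms_def)
  note F = free_id_representation_via_laplace_char[OF rep]
  note F' = free_id_representation_via_laplace_char[OF rep']
  have "of_real a + \<i> * of_real (b + measure \<rho> UNIV) = of_real a' + \<i> * of_real (b' + measure \<rho>' UNIV)"
    using F[of 1] F'[of 1] by simp
  then have a: "a' = a" and c: "b + measure \<rho> UNIV = b' + measure \<rho>' UNIV"
    by (auto simp: complex_eq_iff)
  let ?L = "\<lambda>\<rho> w. (LINT t:{0<..}|lborel. of_real (exp (- (w * t))) * char \<rho> t)"
  have laplace: "?L \<rho> w = ?L \<rho>' w" if "w > 1" for w
  proof -
    have "\<i> * of_real (w\<^sup>2 - 1) * ?L \<rho> w = \<i> * of_real (w\<^sup>2 - 1) * ?L \<rho>' w"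
    proof -
      have "of_real a + \<i> * of_real ((b' + measure \<rho>' UNIV) * w) - \<i> * of_real (w\<^sup>2 - 1) * ?L \<rho> w
          = of_real a + \<i> * of_real ((b' + measure \<rho>' UNIV) * w) - \<i> * of_real (w\<^sup>2 - 1) * ?L \<rho>' w"
        using trans[OF F[of w, symmetric] F'[of w]] that unfolding a c by linarith
      then show ?thesis by (simp only: diff_left_imp_eq)
    qed
    moreover have "\<i> * complex_of_real (w\<^sup>2 - 1) \<noteq> 0"
      using that by (simp only: mult_eq_0_iff of_real_eq_0_iff) (auto simp: power2_eq_1_iff)
    ultimately show ?thesis by (simp only: mult_cancel_left) blast
  qed
  \<comment> \<open>Laplace transforms at integers from 2 on suffice for nonnegative arguments; the other half
    of the line follows by conjugation.\<close>
  have char_pos: "char \<rho> t - char \<rho>' t = 0" if "t \<ge> 0" for t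
  proof (rule complex_continuous_zero_if_laplace_moments_vanish[where g = "\<lambda>t. char \<rho> t - char \<rho>' t", OF _ _ _ that])
    show "norm (char \<rho> t - char \<rho>' t) \<le> measure \<rho> UNIV + measure \<rho>' UNIV" for t
      using norm_triangle_ineq4[of "char \<rho> t" "char \<rho>' t"] \<rho>.norm_char_le[of t] \<rho>'.norm_char_le[of t]
      by linarith
    show cont: "continuous_on UNIV (\<lambda>t. char \<rho> t - char \<rho>' t)"
      by (intro continuous_on_diff continuous_at_imp_continuous_on ballI \<rho>.isCont_char_finite \<rho>'.isCont_char_finite)
    show "(LINT t:{0<..}|lborel. of_real (exp (- ((real n + 2) * t))) * (char \<rho> t - char \<rho>' t)) = 0" for n
    proof -
      have "set_integrable lborel {0<..} (\<lambda>t. of_real (exp (- ((real n + 2) * t))) * char M t)"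
        if "finite_borel_measure M" for M
      proof (rule set_integrable_of_exp_bound[where c = "real n + 2" and C = "measure M UNIV"])
        interpret finite_borel_measure M by fact
        have [measurable]: "char M \<in> borel_measurable borel"
          by (intro borel_measurable_continuous_onI continuous_at_imp_continuous_on ballI isCont_char_finite)
        show "set_borel_measurable lborel {0<..} (\<lambda>t. of_real (exp (- ((real n + 2) * t))) * char M t)"
          by (simp add: set_borel_measurable_def)
        show "norm (of_real (exp (- ((real n + 2) * x))) * char M x)
            \<le> measure M UNIV * exp (- ((real n + 2) * x))" for x
          using norm_char_le[of x] by (simp add: norm_mult)
      qed auto
      from this[OF \<rho>.finite_borel_measure_axioms] this[OF \<rho>'.finite_borel_measure_axioms]
      show ?thesis
        using laplace[of "real n + 2"] by (simp add: right_diff_distrib)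
    qed
  qed
  have "char \<rho> t = char \<rho>' t" for t
    using char_pos[of t] char_pos[of "- t"] by (cases "t \<ge> 0") (auto simp: \<rho>.char_minus \<rho>'.char_minus)
  then have "\<rho>' = \<rho>"
    by (intro finite_measure_eq_if_char_eq \<rho>.finite_borel_measure_axioms \<rho>'.finite_borel_measure_axioms) auto
  with a c show ?thesis by simp
qed

section \<open>The partial fraction expansion of the squared hyperbolic secant\<close>

lemma sin_pi_nonzero_if_not_Int:
  fixes z :: complex
  assumes "z \<notin> \<int>"
  shows "sin (of_real pi * z) \<noteq> 0"
proof
  assume "sin (of_real pi * z) = 0"
  then obtain n :: int where "of_real pi * z = of_real (of_int n * pi)"
    by (auto simp: sin_eq_0)
  then have "of_real pi * z = of_real pi * of_int n" by (simp add: mult.commute)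
  then have "z = of_int n" by (subst (asm) mult_cancel_left) simp
  with assms show False by simp
qed

lemma not_nonpos_Ints_if_not_Int:
  fixes z :: complex
  assumes "z \<notin> \<int>"
  shows "z \<notin> \<int>\<^sub>\<le>\<^sub>0" "1 - z \<notin> \<int>\<^sub>\<le>\<^sub>0"
proof -
  show "z \<notin> \<int>\<^sub>\<le>\<^sub>0" using assms nonpos_Ints_Int by blast
  show "1 - z \<notin> \<int>\<^sub>\<le>\<^sub>0"
  proof
    assume "1 - z \<in> \<int>\<^sub>\<le>\<^sub>0"
    then have "1 - (1 - z) \<in> \<int>" using nonpos_Ints_Int by (intro Ints_diff) auto
    with assms show False by simp
  qed
qed

text \<open>
  The logarithmic derivative of Euler's reflection formula.
\<close>

lemma Digamma_reflection_complex:
  fixes z :: complex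
  assumes z: "z \<notin> \<int>"
  shows "Digamma z - Digamma (1 - z) = - of_real pi * cot (of_real pi * z)"
proof -
  note nz = not_nonpos_Ints_if_not_Int[OF z] sin_pi_nonzero_if_not_Int[OF z]
  have "((\<lambda>z. Gamma z * Gamma (1 - z)) has_field_derivative
      Gamma z * Gamma (1 - z) * (Digamma z - Digamma (1 - z))) (at z)"
    using nz by (auto intro!: derivative_eq_intros simp: algebra_simps)
  moreover have "((\<lambda>z. of_real pi / sin (of_real pi * z)) has_field_derivative
      of_real pi / sin (of_real pi * z) * (- of_real pi * cot (of_real pi * z))) (at z)"
    using nz by (auto intro!: derivative_eq_intros simp: cot_def power2_eq_square)
  ultimately have "of_real pi / sin (of_real pi * z) * (Digamma z - Digamma (1 - z))
      = of_real pi / sin (of_real pi * z) * (- of_real pi * cot (of_real pi * z))"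
    unfolding Gamma_reflection_complex by (rule DERIV_unique)
  moreover have "of_real pi / sin (of_real pi * z) \<noteq> 0" using nz by simp
  ultimately show ?thesis by (simp only: mult_cancel_left) blast
qed

text \<open>
  One more derivative turns the cotangent into the squared cosecant and Digamma into the trigamma
  function, which is a series of inverse squares: this is how the partial fraction expansion of
  the squared cosecant is obtained.
\<close>

lemma Polygamma_1_reflection_complex:
  fixes z :: complex
  assumes z: "z \<notin> \<int>"
  shows "Polygamma 1 z + Polygamma 1 (1 - z) = (of_real pi / sin (of_real pi * z))\<^sup>2"
proof -
  note nz = not_nonpos_Ints_if_not_Int[OF z] sin_pi_nonzero_if_not_Int[OF z]
  have "((\<lambda>z. - of_real pi * cot (of_real pi * z)) has_field_derivative
      (of_real pi / sin (of_real pi * z))\<^sup>2) (at z)"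
    using nz DERIV_chain2[OF DERIV_cot[OF nz(3)] DERIV_cmult_Id[of "of_real pi"]]
    by (auto intro!: derivative_eq_intros simp: field_simps power2_eq_square)
  then have "((\<lambda>z. Digamma z - Digamma (1 - z)) has_field_derivative
      (of_real pi / sin (of_real pi * z))\<^sup>2) (at z)"
    by (rule has_field_derivative_transform_within_open[where S = "- \<int>"])
       (use z Digamma_reflection_complex in \<open>auto intro: open_Compl closed_Ints\<close>)
  moreover have "((\<lambda>z. Digamma z - Digamma (1 - z)) has_field_derivative
      Polygamma 1 z + Polygamma 1 (1 - z)) (at z)"
    using nz by (auto intro!: derivative_eq_intros)
  ultimately show ?thesis by (blast intro: DERIV_unique)
qed

text \<open>
  These numbers are the positive zeros of the cosine; the poles of \<open>1 / (cosh t)\<^sup>2\<close> are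
  \<open>\<plusminus> i\<close> times them.
\<close>

definition odd_half_pi :: "nat \<Rightarrow> real" where
  "odd_half_pi k = (real k + 1 / 2) * pi"

lemma odd_half_pi_pos [simp]: "odd_half_pi k > 0"
  by (simp add: odd_half_pi_def)

text \<open>
  Evaluating trigamma reflection at \<open>z = 1/2 + i t / pi\<close>, where \<open>sin (pi z) = cosh t\<close>, makes the two
  trigamma series complex conjugates of each other, so that they add up to twice a real part.
\<close>

lemma inverse_square_sech_sums:
  "(\<lambda>k. 2 * Re (1 / (of_real (odd_half_pi k) - \<i> * of_real t)\<^sup>2)) sums (1 / (cosh t)\<^sup>2)"
proof -
  define z where "z = 1 / 2 + \<i> * of_real (t / pi)"
  have z: "z \<notin> \<int>"
  proof
    assume "z \<in> \<int>"
    then obtain n :: int where n: "z = of_int n" by (auto elim: Ints_cases)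
    then have "Re z = of_int n" by simp
    then have "of_int (2 * n) = (1 :: real)" by (simp add: z_def)
    then have "2 * n = 1" by (simp only: of_int_eq_1_iff)
    then show False by presburger
  qed
  have nz: "z \<noteq> 0" "1 - z \<noteq> 0" by (auto simp: z_def complex_eq_iff)
  have "sin (of_real pi * z) = cos (\<i> * of_real t)"
    by (simp add: z_def ring_distribs sin_add flip: cos_of_real sin_of_real)
  also have "\<dots> = of_real (cosh t)"
    by (simp add: cosh_conv_cos[symmetric] cosh_def exp_of_real[symmetric] scaleR_conv_of_real)
  finally have sin: "sin (of_real pi * z) = of_real (cosh t)" .
  have "(\<lambda>k. inverse ((z + of_nat k)\<^sup>2)) sums Polygamma 1 z"
       "(\<lambda>k. inverse ((1 - z + of_nat k)\<^sup>2)) sums Polygamma 1 (1 - z)"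
    using Polygamma_converges'[OF nz(1), of 2] Polygamma_converges'[OF nz(2), of 2]
    by (simp_all add: Polygamma_def summable_sums numeral_2_eq_2)
  then have "(\<lambda>k. inverse ((z + of_nat k)\<^sup>2) + inverse ((1 - z + of_nat k)\<^sup>2))
      sums (of_real pi / of_real (cosh t))\<^sup>2"
    unfolding sin[symmetric] Polygamma_1_reflection_complex[OF z, symmetric] by (rule sums_add)
  then have "(\<lambda>k. Re ((inverse ((z + of_nat k)\<^sup>2) + inverse ((1 - z + of_nat k)\<^sup>2)) / (of_real pi)\<^sup>2))
      sums Re ((of_real pi / of_real (cosh t))\<^sup>2 / (of_real pi)\<^sup>2)"
    by (intro sums_Re sums_divide)
  also have "(of_real pi / of_real (cosh t))\<^sup>2 / (of_real pi)\<^sup>2 = complex_of_real (1 / (cosh t)\<^sup>2)"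
    by (simp add: power_divide)
  also have "(\<lambda>k. Re ((inverse ((z + of_nat k)\<^sup>2) + inverse ((1 - z + of_nat k)\<^sup>2)) / (of_real pi)\<^sup>2))
      = (\<lambda>k. 2 * Re (1 / (of_real (odd_half_pi k) - \<i> * of_real t)\<^sup>2))"
  proof
    fix k
    define c where "c = of_real (odd_half_pi k) - \<i> * of_real t"
    have "(z + of_nat k) * of_real pi = cnj c" "(1 - z + of_nat k) * of_real pi = c"
      by (auto simp: z_def c_def odd_half_pi_def complex_eq_iff field_simps)
    then have "(inverse ((z + of_nat k)\<^sup>2) + inverse ((1 - z + of_nat k)\<^sup>2)) / (of_real pi)\<^sup>2
        = 1 / (cnj c)\<^sup>2 + 1 / c\<^sup>2"
      by (metis (no_types, opaque_lifting) add_divide_distrib divide_divide_eq_left inverse_eq_divide power_mult_distrib)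
    also have "\<dots> = cnj (1 / c\<^sup>2) + 1 / c\<^sup>2" by simp
    finally show "Re ((inverse ((z + of_nat k)\<^sup>2) + inverse ((1 - z + of_nat k)\<^sup>2)) / (of_real pi)\<^sup>2)
      = 2 * Re (1 / (of_real (odd_half_pi k) - \<i> * of_real t)\<^sup>2)"
      unfolding c_def[symmetric] by (simp only: plus_complex.sel cnj.sel)
  qed
  finally show ?thesis by simp
qed

section \<open>The cosine transform of the hyperbolic kernel\<close>

definition sinh_kernel :: "real \<Rightarrow> real" where
  "sinh_kernel x = x / sinh (pi / 2 * x)"

lemma sinh_kernel_nonneg: "sinh_kernel x \<ge> 0"
  by (cases "x \<ge> 0") (auto simp: sinh_kernel_def divide_nonpos_nonpos mult_nonneg_nonpos)

lemma sinh_kernel_even: "sinh_kernel (- x) = sinh_kernel x"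
  by (simp add: sinh_kernel_def)

lemma sinh_kernel_measurable [measurable]: "sinh_kernel \<in> borel_measurable borel"
  unfolding sinh_kernel_def[abs_def] sinh_def by measurable

text \<open>
  The geometric series of \<open>1 / sinh\<close>. Its exponents are the same numbers as in the expansion of
  \<open>1 / (cosh t)\<^sup>2\<close>, and this is what links the two functions.
\<close>

lemma sinh_kernel_exp_series:
  assumes "x > 0"
  shows "(\<lambda>k. 2 * (x * exp (- (odd_half_pi k * x)))) sums sinh_kernel x"
proof -
  define q where "q = exp (- (pi * x))"
  have q: "0 < q" "q < 1" using assms by (auto simp: q_def)
  have half: "exp (- (pi / 2 * x)) * exp (- (pi / 2 * x)) = q"
    by (simp add: q_def flip: exp_add)
  have "(\<lambda>k. 2 * x * exp (- (pi / 2 * x)) * q ^ k) sums (2 * x * exp (- (pi / 2 * x)) * (1 / (1 - q)))"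
    using q by (intro sums_mult geometric_sums) auto
  also have "2 * x * exp (- (pi / 2 * x)) * (1 / (1 - q)) = sinh_kernel x"
  proof -
    have "sinh (pi / 2 * x) * (2 * exp (- (pi / 2 * x))) = 1 - q"
      unfolding half[symmetric] by (simp add: sinh_def algebra_simps flip: exp_add)
    moreover have "sinh (pi / 2 * x) > 0" using assms by simp
    ultimately show ?thesis
      using q unfolding sinh_kernel_def by (simp add: divide_simps) (simp add: mult_ac)
  qed
  also have "(\<lambda>k. 2 * x * exp (- (pi / 2 * x)) * q ^ k) = (\<lambda>k. 2 * (x * exp (- (odd_half_pi k * x))))"
    by (auto simp: q_def odd_half_pi_def algebra_simps simp flip: exp_of_nat_mult exp_add)
  finally show ?thesis .
qed

lemma cos_transform_mult_exp:
  fixes c t :: real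
  assumes "c > 0"
  shows "set_integrable lborel {0<..} (\<lambda>x. cos (t * x) * (x * exp (- (c * x))))"
    and "(LINT x:{0<..}|lborel. cos (t * x) * (x * exp (- (c * x)))) = Re (1 / (of_real c - \<i> * of_real t)\<^sup>2)"
proof -
  let ?z = "of_real c - \<i> * of_real t"
  have Re: "Re (of_real x * exp (- (?z * of_real x))) = cos (t * x) * (x * exp (- (c * x)))" for x
    by (simp add: Re_exp mult_ac)
  have z: "Re ?z > 0" using assms by simp
  note int = set_integrable_mult_exp_complex[OF z]
  show "set_integrable lborel {0<..} (\<lambda>x. cos (t * x) * (x * exp (- (c * x))))"
    using integrable_Re[OF int[unfolded set_integrable_def]] unfolding Re[symmetric] set_integrable_def by simp
  show "(LINT x:{0<..}|lborel. cos (t * x) * (x * exp (- (c * x)))) = Re (1 / ?z\<^sup>2)"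
    using integral_Re[OF int[unfolded set_integrable_def]]
    unfolding set_integral_mult_exp_complex[OF z, symmetric] Re[symmetric] set_lebesgue_integral_def by simp
qed

text \<open>
  Integrating the exponential series of the kernel term by term gives exactly the partial fraction
  series of \<open>1 / (cosh t)\<^sup>2\<close>. The instance \<open>t = 0\<close> of the latter also supplies the summable bound
  that justifies the exchange.
\<close>

lemma cos_transform_sinh_kernel:
  shows "set_integrable lborel {0<..} (\<lambda>x. cos (t * x) * sinh_kernel x)"
    and "(LINT x:{0<..}|lborel. cos (t * x) * sinh_kernel x) = 1 / (cosh t)\<^sup>2"
proof -
  let ?f = "\<lambda>k x. indicator {0<..} x *\<^sub>R (2 * (cos (t * x) * (x * exp (- (odd_half_pi k * x)))))"
  have int: "integrable lborel (?f k)" for k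
    using cos_transform_mult_exp(1)[of "odd_half_pi k" t] unfolding set_integrable_def[symmetric] by simp
  have val: "integral\<^sup>L lborel (?f k) = 2 * Re (1 / (of_real (odd_half_pi k) - \<i> * of_real t)\<^sup>2)" for k
    using cos_transform_mult_exp(2)[of "odd_half_pi k" t] unfolding set_lebesgue_integral_def[symmetric] by simp
  have sums: "(\<lambda>k. ?f k x) sums (indicator {0<..} x *\<^sub>R (cos (t * x) * sinh_kernel x))" for x
  proof (cases "x > 0")
    case True
    show ?thesis using sums_mult[OF sinh_kernel_exp_series[OF True], of "cos (t * x)"] True
      by (simp add: mult_ac)
  qed auto
  \<comment> \<open>The bound is written as the case \<open>t = 0\<close> so that its integral is already known.\<close>
  have abs_le: "norm (?f k x) \<le> indicator {0<..} x *\<^sub>R (2 * (cos (0 * x) * (x * exp (- (odd_half_pi k * x)))))" for k x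
    by (auto split: split_indicator simp: abs_mult mult_left_le_one_le)
  have int0: "integrable lborel (\<lambda>x. indicator {0<..} x *\<^sub>R (2 * (cos (0 * x) * (x * exp (- (odd_half_pi k * x))))))" for k
    using cos_transform_mult_exp(1)[of "odd_half_pi k" 0] unfolding set_integrable_def[symmetric] by simp
  have bound: "(\<integral>x. norm (?f k x) \<partial>lborel) \<le> 2 * Re (1 / (of_real (odd_half_pi k) - \<i> * of_real 0)\<^sup>2)" for k
  proof -
    have "(\<integral>x. norm (?f k x) \<partial>lborel) \<le> (\<integral>x. indicator {0<..} x *\<^sub>R (2 * (cos (0 * x) * (x * exp (- (odd_half_pi k * x))))) \<partial>lborel)"
      by (intro integral_mono integrable_norm int int0 abs_le)
    also have "\<dots> = 2 * Re (1 / (of_real (odd_half_pi k) - \<i> * of_real 0)\<^sup>2)"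
      using cos_transform_mult_exp(2)[of "odd_half_pi k" 0] unfolding set_lebesgue_integral_def[symmetric] by simp
    finally show ?thesis .
  qed
  have sum1: "summable (\<lambda>k. \<integral>x. norm (?f k x) \<partial>lborel)"
    by (rule summable_comparison_test'[OF sums_summable[OF inverse_square_sech_sums[of 0]]])
       (use bound in \<open>auto simp: integral_nonneg_AE\<close>)
  have sum2: "AE x in lborel. summable (\<lambda>k. norm (?f k x))"
  proof (rule AE_I2)
    fix x
    show "summable (\<lambda>k. norm (?f k x))"
    proof (cases "x > 0")
      case True
      show ?thesis
        by (rule summable_comparison_test'[OF sums_summable[OF sinh_kernel_exp_series[OF True]]])
           (use True in \<open>auto simp: abs_mult mult_left_le_one_le\<close>)
    qed auto
  qed
  have suminf: "(\<Sum>k. ?f k x) = indicator {0<..} x *\<^sub>R (cos (t * x) * sinh_kernel x)" for x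
    using sums[of x] by (rule sums_unique[symmetric])
  show "set_integrable lborel {0<..} (\<lambda>x. cos (t * x) * sinh_kernel x)"
    using integrable_suminf[OF int sum2 sum1] unfolding suminf set_integrable_def .
  have "(\<lambda>k. integral\<^sup>L lborel (?f k)) sums (LINT x:{0<..}|lborel. cos (t * x) * sinh_kernel x)"
    using sums_integral[OF int sum2 sum1] unfolding suminf set_lebesgue_integral_def .
  then show "(LINT x:{0<..}|lborel. cos (t * x) * sinh_kernel x) = 1 / (cosh t)\<^sup>2"
    unfolding val using inverse_square_sech_sums[of t] by (rule sums_unique2)
qed

lemma set_integrable_sinh_kernel: "set_integrable lborel {0<..} sinh_kernel"
  using cos_transform_sinh_kernel(1)[of 0] by simp

lemma poisson_cos_integral:
  fixes w x :: real
  assumes "w > 0"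
  shows "(LINT u:{0<..}|lborel. exp (- (w * u)) * cos (u * x)) = w / (w\<^sup>2 + x\<^sup>2)"
proof -
  let ?z = "of_real w - \<i> * of_real x"
  have Re: "Re (exp (- (?z * of_real u))) = exp (- (w * u)) * cos (u * x)" for u
    by (simp add: Re_exp mult_ac)
  have z: "Re ?z > 0" using assms by simp
  have "(LINT u:{0<..}|lborel. exp (- (w * u)) * cos (u * x)) = Re (1 / ?z)"
    using integral_Re[OF set_integrable_exp_complex[OF z, unfolded set_integrable_def]]
    unfolding set_integral_exp_complex[OF z, symmetric] Re[symmetric] set_lebesgue_integral_def by simp
  then show ?thesis by (simp add: Re_divide)
qed

text \<open>
  The factor \<open>w / (w\<^sup>2 + x\<^sup>2)\<close> is the integral of \<open>exp (- w u) * cos (u x)\<close> over \<open>u > 0\<close>; after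
  exchanging the integrals, the product formula for cosines reduces the inner one to the cosine
  transform of the kernel. The case \<open>w = 1\<close> yields the characteristic function of the measure
  constructed below, the case \<open>s = 0\<close> its Nevanlinna integral.
\<close>

lemma cos_transform_sinh_kernel_poisson:
  fixes w s :: real
  assumes "w > 0"
  shows "(LINT x:{0<..}|lborel. cos (s * x) * (sinh_kernel x * (w / (w\<^sup>2 + x\<^sup>2))))
    = (LINT u:{0<..}|lborel. exp (- (w * u)) * (1 / (cosh (s + u))\<^sup>2 + 1 / (cosh (s - u))\<^sup>2)) / 2"
proof -
  let ?g = "\<lambda>x u. (indicator {0<..} x *\<^sub>R sinh_kernel x) * ((indicator {0<..} u *\<^sub>R exp (- (w * u))) * (cos (s * x) * cos (u * x)))"
  have "(LINT x:{0<..}|lborel. cos (s * x) * (sinh_kernel x * (w / (w\<^sup>2 + x\<^sup>2)))) = (\<integral>x. (\<integral>u. ?g x u \<partial>lborel) \<partial>lborel)"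
    unfolding poisson_cos_integral[OF assms, symmetric] set_lebesgue_integral_def
    by (intro Bochner_Integration.integral_cong refl)
       (simp only: integral_mult_right_zero[symmetric] integral_scaleR_right[symmetric], simp add: mult_ac)
  also have "\<dots> = (\<integral>u. (\<integral>x. ?g x u \<partial>lborel) \<partial>lborel)"
  proof (rule Fubini_dominated_by_product[symmetric])
    show "integrable lborel (\<lambda>x. indicator {0<..} x *\<^sub>R sinh_kernel x)"
      using set_integrable_sinh_kernel by (simp add: set_integrable_def)
    show "integrable lborel (\<lambda>u. indicator {0<..} u *\<^sub>R exp (- (w * u)))"
      using set_integrable_exp_decay[OF assms] by (simp add: set_integrable_def)
    show "norm (?g x u) \<le> (indicator {0<..} x *\<^sub>R sinh_kernel x) * (indicator {0<..} u *\<^sub>R exp (- (w * u)))" for x u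
    proof -
      have "\<bar>cos (s * x) * cos (u * x)\<bar> \<le> 1"
        by (simp add: abs_mult mult_le_one)
      then show ?thesis
        using mult_left_mono[of "\<bar>cos (s * x) * cos (u * x)\<bar>" 1 "sinh_kernel x * exp (- (w * u))"] sinh_kernel_nonneg[of x]
        by (auto simp: abs_mult mult_ac split: split_indicator)
    qed
  qed (auto simp: lborel.sigma_finite_measure_axioms)
  also have "\<dots> = (\<integral>u. indicator {0<..} u *\<^sub>R (exp (- (w * u)) * (1 / (cosh (s + u))\<^sup>2 + 1 / (cosh (s - u))\<^sup>2)) / 2 \<partial>lborel)"
  proof (intro Bochner_Integration.integral_cong refl)
    fix u
    have "?g x u = (indicator {0<..} u *\<^sub>R exp (- (w * u)) / 2) *
        (indicator {0<..} x *\<^sub>R (cos ((s + u) * x) * sinh_kernel x) + indicator {0<..} x *\<^sub>R (cos ((s - u) * x) * sinh_kernel x))" for x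
      by (simp add: cos_times_cos ring_distribs mult_ac)
    then have "(\<integral>x. ?g x u \<partial>lborel) = (indicator {0<..} u *\<^sub>R exp (- (w * u)) / 2) *
        (\<integral>x. (indicator {0<..} x *\<^sub>R (cos ((s + u) * x) * sinh_kernel x) + indicator {0<..} x *\<^sub>R (cos ((s - u) * x) * sinh_kernel x)) \<partial>lborel)"
      by (simp only: integral_mult_right_zero)
    also have "(\<integral>x. (indicator {0<..} x *\<^sub>R (cos ((s + u) * x) * sinh_kernel x) + indicator {0<..} x *\<^sub>R (cos ((s - u) * x) * sinh_kernel x)) \<partial>lborel)
        = 1 / (cosh (s + u))\<^sup>2 + 1 / (cosh (s - u))\<^sup>2"
      using cos_transform_sinh_kernel[of "s + u"] cos_transform_sinh_kernel[of "s - u"]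
      unfolding set_integrable_def set_lebesgue_integral_def by simp
    finally show "(\<integral>x. ?g x u \<partial>lborel) = indicator {0<..} u *\<^sub>R (exp (- (w * u)) * (1 / (cosh (s + u))\<^sup>2 + 1 / (cosh (s - u))\<^sup>2)) / 2"
      by simp
  qed
  finally show ?thesis by (simp add: set_lebesgue_integral_def)
qed

section \<open>Closed forms\<close>

lemma inverse_cosh_square_le_1: "1 / (cosh x)\<^sup>2 \<le> (1 :: real)"
  using one_le_power[OF cosh_real_ge_1, of x 2] by simp

lemma set_integrable_exp_sech_square:
  fixes s w :: real
  assumes "w > 0"
  shows "set_integrable lborel {0<..} (\<lambda>u. exp (- (w * u)) * (1 / (cosh (s + u))\<^sup>2))"
proof (rule set_integrable_of_exp_bound[where c = w and C = 1])
  show "set_borel_measurable lborel {0<..} (\<lambda>u. exp (- (w * u)) * (1 / (cosh (s + u))\<^sup>2))"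
    unfolding set_borel_measurable_def cosh_def by measurable
  show "norm (exp (- (w * u)) * (1 / (cosh (s + u))\<^sup>2)) \<le> 1 * exp (- (w * u))" for u
    using mult_left_mono[OF inverse_cosh_square_le_1[of "s + u"], of "exp (- (w * u))"] by simp
qed fact

text \<open>
  In the variable \<open>y = exp (s + u)\<close> the integrand is a multiple of \<open>1 / (1 + y\<^sup>2)\<^sup>2\<close>, whose
  antiderivative is a combination of \<open>y / (1 + y\<^sup>2)\<close> and the arcus tangent.
\<close>

lemma exp_sech_square_integral:
  fixes s :: real
  shows "(LINT u:{0<..}|lborel. exp (- u) * (1 / (cosh (s + u))\<^sup>2))
    = exp s * (2 * arctan (exp (- s)) - 1 / cosh s)"
proof -
  let ?F = "\<lambda>u. exp s * (1 / cosh (s + u) + 2 * arctan (exp (s + u)))"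
  have "(LINT u:{0<..}|lborel. exp (- u) * (1 / (cosh (s + u))\<^sup>2))
      = exp s * (0 + 2 * (pi / 2)) - exp s * (1 / cosh s + 2 * arctan (exp s))"
  proof (rule set_integral_half_line_FTC[where F = ?F])
    fix u :: real
    show "(?F has_vector_derivative exp (- u) * (1 / (cosh (s + u))\<^sup>2)) (at u)"
      unfolding has_real_derivative_iff_has_vector_derivative[symmetric]
    proof -
      define v where "v = s + u"
      have arctan_part: "2 * (exp v / (1 + (exp v)\<^sup>2)) = 1 / cosh v"
        by (simp add: cosh_field_def exp_minus field_simps power2_eq_square)
      have exp_v: "exp s * (cosh v - sinh v) = exp (- u)"
        by (simp add: cosh_minus_sinh v_def flip: exp_add)
      have "(?F has_real_derivative exp s * (- sinh v / (cosh v)\<^sup>2 + 2 * (exp v / (1 + (exp v)\<^sup>2)))) (at u)"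
        unfolding v_def by (auto intro!: derivative_eq_intros simp: power2_eq_square divide_inverse)
      also have "exp s * (- sinh v / (cosh v)\<^sup>2 + 2 * (exp v / (1 + (exp v)\<^sup>2)))
          = exp s * (cosh v - sinh v) / (cosh v)\<^sup>2"
        unfolding arctan_part by (simp add: field_simps power2_eq_square)
      finally show "(?F has_real_derivative exp (- u) * (1 / (cosh (s + u))\<^sup>2)) (at u)"
        unfolding exp_v by (simp add: v_def)
    qed
    show "isCont (\<lambda>u. exp (- u) * (1 / (cosh (s + u))\<^sup>2)) u"
      by (auto intro!: continuous_intros)
  next
    show "set_integrable lborel {0<..} (\<lambda>u. exp (- u) * (1 / (cosh (s + u))\<^sup>2))"
      using set_integrable_exp_sech_square[of 1 s] by simp
    show "(?F \<longlongrightarrow> exp s * (1 / cosh s + 2 * arctan (exp s))) (at_right 0)"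
      by (rule tendsto_eq_intros refl | simp)+
    have shift: "filterlim (\<lambda>u. s + u) at_top at_top"
      by (rule filterlim_tendsto_add_at_top[OF tendsto_const filterlim_ident])
    have "((\<lambda>u. 1 / cosh (s + u)) \<longlongrightarrow> 0) at_top"
      by (rule filterlim_compose[OF _ shift, of "\<lambda>v. 1 / cosh v"])
         (unfold cosh_field_def, real_asymp)
    moreover have "((\<lambda>u. arctan (exp (s + u))) \<longlongrightarrow> pi / 2) at_top"
      by (rule filterlim_compose[OF tendsto_arctan_at_top filterlim_compose[OF exp_at_top shift]])
    ultimately show "(?F \<longlongrightarrow> exp s * (0 + 2 * (pi / 2))) at_top"
      by (intro tendsto_intros)
  qed
  also have "arctan (exp s) = pi / 2 - arctan (exp (- s))"
    using arctan_inverse[of "exp s"] by (simp add: exp_minus inverse_eq_divide)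
  finally show ?thesis by (simp add: algebra_simps)
qed

text \<open>
  Because \<open>1 / (cosh t)\<^sup>2\<close> is even, the two summands of the Poisson formula at \<open>w = 1\<close> are the
  integral of the previous lemma at \<open>s\<close> and at \<open>- s\<close>.
\<close>

lemma cos_transform_sinh_kernel_cauchy:
  fixes s :: real
  shows "(LINT x:{0<..}|lborel. cos (s * x) * (sinh_kernel x * (1 / (1 + x\<^sup>2))))
    = 2 * sinh s * arctan (exp (- s)) + pi / 2 * exp (- s) - 1"
proof -
  let ?A = "\<lambda>s. exp s * (2 * arctan (exp (- s)) - 1 / cosh s)"
  have even: "1 / (cosh (s - u))\<^sup>2 = 1 / (cosh (- s + u))\<^sup>2" for u
    using cosh_minus[of "s - u"] by simp
  have "(LINT x:{0<..}|lborel. cos (s * x) * (sinh_kernel x * (1 / (1 + x\<^sup>2))))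
      = (LINT u:{0<..}|lborel. exp (- u) * (1 / (cosh (s + u))\<^sup>2) + exp (- u) * (1 / (cosh (- s + u))\<^sup>2)) / 2"
    using cos_transform_sinh_kernel_poisson[of 1 s] unfolding even distrib_left by simp
  also have "\<dots> = (?A s + ?A (- s)) / 2"
    using set_integrable_exp_sech_square[of 1 s] set_integrable_exp_sech_square[of 1 "- s"]
    by (subst set_integral_add(2)) (simp_all only: exp_sech_square_integral mult_1 zero_less_one)
  also have "?A s + ?A (- s) = 2 * (exp s * arctan (exp (- s)) + exp (- s) * (pi / 2 - arctan (exp (- s)))) - 2"
  proof -
    have "arctan (exp s) = pi / 2 - arctan (exp (- s))"
      using arctan_inverse[of "exp s"] by (simp add: exp_minus inverse_eq_divide)
    moreover have "exp s / cosh s + exp (- s) / cosh s = 2"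
    proof -
      have "exp s + exp (- s) = 2 * cosh s" by (simp add: cosh_field_def)
      then show ?thesis by (simp add: add_divide_distrib[symmetric])
    qed
    moreover have "?A s + ?A (- s) = 2 * (exp s * arctan (exp (- s)) + exp (- s) * arctan (exp s))
        - (exp s / cosh s + exp (- s) / cosh s)"
      by (simp add: algebra_simps)
    ultimately show ?thesis by simp
  qed
  also have "(2 * (exp s * arctan (exp (- s)) + exp (- s) * (pi / 2 - arctan (exp (- s)))) - 2) / 2
      = 2 * sinh s * arctan (exp (- s)) + pi / 2 * exp (- s) - 1"
  proof -
    have "2 * sinh s = exp s - exp (- s)" by (simp add: sinh_field_def)
    then show ?thesis
      by (simp only: diff_divide_distrib nonzero_mult_div_cancel_left zero_neq_numeral[symmetric] not_False_eq_True divide_self)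
         (simp add: algebra_simps)
  qed
  finally show ?thesis .
qed

text \<open>
  Integration by parts: the factor \<open>w\<close> is absorbed by differentiating the exponential, the boundary
  term at 0 contributes 1, and the derivative of \<open>1 / (1 + exp (- x))\<close> is
  \<open>1 / (4 (cosh (x / 2))\<^sup>2)\<close>. The scaling \<open>x = 2 u\<close> gives the stated form.
\<close>

lemma mult_nielsen_beta_half:
  assumes "w > 0"
  shows "of_real w * nielsen_beta (of_real (w / 2))
    = of_real (1 + (LINT u:{0<..}|lborel. exp (- (w * u)) * (1 / (cosh u)\<^sup>2)))"
proof -
  let ?b = "\<lambda>x. exp (- (w / 2 * x)) / (1 + exp (- x))"
  let ?r = "\<lambda>x. exp (- (w / 2 * x)) * (1 / (cosh (x / 2))\<^sup>2)"
  have pos: "1 + exp (- x) \<noteq> (0 :: real)" for x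
    using exp_gt_zero[of "- x"] by linarith
  have int_b: "set_integrable lborel {0<..} ?b"
  proof (rule set_integrable_of_exp_bound[where c = "w / 2" and C = 1])
    show "norm (?b x) \<le> 1 * exp (- (w / 2 * x))" for x
      by (simp add: abs_of_pos divide_le_eq add_pos_pos)
  qed (use assms in \<open>auto simp: set_borel_measurable_def\<close>)
  have int_r: "set_integrable lborel {0<..} ?r"
  proof (rule set_integrable_of_exp_bound[where c = "w / 2" and C = 1])
    show "set_borel_measurable lborel {0<..} ?r"
      unfolding set_borel_measurable_def cosh_def by measurable
    show "norm (?r x) \<le> 1 * exp (- (w / 2 * x))" for x
      using mult_left_mono[OF inverse_cosh_square_le_1[of "x / 2"], of "exp (- (w / 2 * x))"] by simp
  qed (use assms in auto)
  have sech: "4 * exp (- x) / (1 + exp (- x))\<^sup>2 = 1 / (cosh (x / 2))\<^sup>2" for x :: real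
  proof -
    have "1 + exp (- x) = 2 * cosh (x / 2) * exp (- (x / 2))"
    proof -
      have "2 * cosh (x / 2) = exp (x / 2) + exp (- (x / 2))" by (simp add: cosh_field_def)
      then show ?thesis by (simp only: ring_distribs exp_add[symmetric]) simp
    qed
    moreover have "exp (- x) = (exp (- (x / 2)))\<^sup>2"
      by (simp add: power2_eq_square flip: exp_add)
    ultimately show ?thesis by (simp add: power_mult_distrib)
  qed
  \<comment> \<open>The integrand is the derivative of \<open>-2 exp (- w x / 2) / (1 + exp (- x))\<close>.\<close>
  have "(LINT x:{0<..}|lborel. w * ?b x - ?r x / 2) = 0 - (- 1)"
  proof (rule set_integral_half_line_FTC[where F = "\<lambda>x. - 2 * ?b x"])
    fix x :: real
    define e q where "e = exp (- (w / 2 * x))" and "q = exp (- x)"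
    have q: "1 + q \<noteq> 0" using pos[of x] by (simp add: q_def)
    have "((\<lambda>x. - 2 * ?b x) has_real_derivative - 2 * ((- (w / 2) * e * (1 + q) - e * (- q)) / ((1 + q) * (1 + q)))) (at x)"
      unfolding e_def q_def
    proof (intro DERIV_cmult DERIV_divide pos)
      show "((\<lambda>x. exp (- (w / 2 * x))) has_real_derivative - (w / 2) * exp (- (w / 2 * x))) (at x)"
        by (auto intro!: derivative_eq_intros)
      show "((\<lambda>x. 1 + exp (- x)) has_real_derivative - exp (- x)) (at x)"
        by (auto intro!: derivative_eq_intros)
    qed
    also have "- 2 * ((- (w / 2) * e * (1 + q) - e * (- q)) / ((1 + q) * (1 + q))) = w * (e / (1 + q)) - e * (4 * q / (1 + q)\<^sup>2) / 2"
      using q by (simp add: divide_simps power2_eq_square)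
    finally have "((\<lambda>x. - 2 * ?b x) has_real_derivative w * ?b x - exp (- (w / 2 * x)) * (4 * exp (- x) / (1 + exp (- x))\<^sup>2) / 2) (at x)"
      by (simp only: e_def q_def)
    then show "((\<lambda>x. - 2 * ?b x) has_vector_derivative w * ?b x - ?r x / 2) (at x)"
      unfolding sech has_real_derivative_iff_has_vector_derivative .
    show "isCont (\<lambda>x. w * ?b x - ?r x / 2) x"
      using pos by (auto intro!: continuous_intros)
  next
    show "set_integrable lborel {0<..} (\<lambda>x. w * ?b x - ?r x / 2)"
      by (intro set_integral_diff set_integrable_mult_right set_integrable_divide int_b int_r)
    have "((\<lambda>x. - 2 * ?b x) \<longlongrightarrow> - 2 * (exp (- (w / 2 * 0)) / (1 + exp (- 0)))) (at_right 0)"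
      using pos by (intro tendsto_intros) auto
    then show "((\<lambda>x. - 2 * ?b x) \<longlongrightarrow> - 1) (at_right 0)" by simp
    show "((\<lambda>x. - 2 * ?b x) \<longlongrightarrow> 0) at_top"
      using assms by real_asymp
  qed
  moreover have "(LINT x:{0<..}|lborel. w * ?b x - ?r x / 2)
      = w * (LINT x:{0<..}|lborel. ?b x) - (LINT x:{0<..}|lborel. ?r x) / 2"
  proof -
    have "(LINT x:{0<..}|lborel. w * ?b x - ?r x / 2) = (LINT x:{0<..}|lborel. w * ?b x) - (LINT x:{0<..}|lborel. ?r x / 2)"
      by (intro set_integral_diff set_integrable_mult_right set_integrable_divide int_b int_r)
    then show ?thesis by (simp only: set_integral_mult_right set_integral_divide_zero)
  qed
  moreover have "(LINT x:{0<..}|lborel. ?r x) / 2 = (LINT u:{0<..}|lborel. exp (- (w * u)) * (1 / (cosh u)\<^sup>2))"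
    unfolding set_lebesgue_integral_def
    by (subst lborel_integral_real_affine[where c = 2 and t = 0])
       (auto intro!: Bochner_Integration.integral_cong split: split_indicator)
  ultimately have b: "w * (LINT x:{0<..}|lborel. ?b x)
      = 1 + (LINT u:{0<..}|lborel. exp (- (w * u)) * (1 / (cosh u)\<^sup>2))"
    by simp
  have "nielsen_beta (of_real (w / 2)) = of_real (LINT x:{0<..}|lborel. ?b x)"
    unfolding nielsen_beta_def set_integral_complex_of_real[symmetric]
    by (simp add: exp_of_real[symmetric])
  then show ?thesis unfolding b[symmetric] by simp
qed

section \<open>The representing measure\<close>

lemma integral_lborel_fold:
  fixes f :: "real \<Rightarrow> 'a::{banach, second_countable_topology}"
  assumes "integrable lborel f"
  shows "integral\<^sup>L lborel f = (LINT x:{0<..}|lborel. f x + f (- x))"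
proof -
  have int: "integrable lborel (\<lambda>x. indicator {0<..} x *\<^sub>R f x)" "integrable lborel (\<lambda>x. indicator {..<0} x *\<^sub>R f x)"
    using assms by (auto intro: integrable_mult_indicator)
  have reflect: "(\<lambda>x. indicator {..<0} (0 + - 1 * x) *\<^sub>R f (0 + - 1 * x)) = (\<lambda>x. indicator {0<..} x *\<^sub>R f (- x))"
    by (auto split: split_indicator)
  have "integral\<^sup>L lborel f = (\<integral>x. indicator {0<..} x *\<^sub>R f x + indicator {..<0} x *\<^sub>R f x \<partial>lborel)"
    using AE_lborel_singleton[of "0 :: real"] int
    by (intro integral_cong_AE borel_measurable_integrable[OF assms] borel_measurable_integrable
          Bochner_Integration.integrable_add)
       (auto elim!: eventually_mono split: split_indicator)
  also have "\<dots> = (\<integral>x. indicator {0<..} x *\<^sub>R f x \<partial>lborel) + (\<integral>x. indicator {..<0} x *\<^sub>R f x \<partial>lborel)"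
    using int by (rule Bochner_Integration.integral_add)
  also have "(\<integral>x. indicator {..<0} x *\<^sub>R f x \<partial>lborel) = (\<integral>x. indicator {0<..} x *\<^sub>R f (- x) \<partial>lborel)"
    unfolding reflect[symmetric] by (subst lborel_integral_real_affine[where c = "-1" and t = 0]) auto
  also have "(\<integral>x. indicator {0<..} x *\<^sub>R f x \<partial>lborel) + \<dots> = (LINT x:{0<..}|lborel. f x + f (- x))"
  proof -
    have "integrable lborel (\<lambda>x. indicator {0<..} x *\<^sub>R f (- x))"
      using lborel_integrable_real_affine[OF int(2), of "-1" 0] unfolding reflect by simp
    then show ?thesis
      using int(1) unfolding set_lebesgue_integral_def scaleR_add_right
      by (intro Bochner_Integration.integral_add[symmetric])
  qed
  finally show ?thesis .
qed

definition rho_C_density :: "real \<Rightarrow> real" where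
  "rho_C_density x = sinh_kernel x * (1 / (1 + x\<^sup>2)) / 2"

definition rho_C :: "real measure" where
  "rho_C = density lborel (\<lambda>x. ennreal (rho_C_density x))"

lemma rho_C_density_double: "2 * rho_C_density x = sinh_kernel x * (1 / (1 + x\<^sup>2))"
proof -
  have "2 * (y / 2) = y" for y :: real by simp
  then show ?thesis unfolding rho_C_density_def .
qed

lemma rho_C_density_nonneg: "rho_C_density x \<ge> 0"
  by (simp add: rho_C_density_def sinh_kernel_nonneg)

lemma rho_C_density_even: "rho_C_density (- x) = rho_C_density x"
  by (simp add: rho_C_density_def sinh_kernel_even)

lemma rho_C_density_measurable [measurable]: "rho_C_density \<in> borel_measurable borel"
  unfolding rho_C_density_def[abs_def] by measurable

lemma set_integrable_rho_C_density: "set_integrable lborel {0<..} rho_C_density"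
proof (rule set_integrable_bound[OF set_integrable_sinh_kernel])
  have "norm (rho_C_density x) \<le> norm (sinh_kernel x)" for x
  proof -
    have "1 / (1 + x\<^sup>2) / 2 \<le> 1" by (simp add: divide_le_eq add_pos_nonneg)
    then show ?thesis
      using mult_left_mono[of "1 / (1 + x\<^sup>2) / 2" 1 "sinh_kernel x"]
      by (simp add: rho_C_density_def sinh_kernel_nonneg)
  qed
  then show "AE x in lborel. x \<in> {0<..} \<longrightarrow> norm (rho_C_density x) \<le> norm (sinh_kernel x)" by auto
qed (auto simp: set_borel_measurable_def)

lemma integrable_rho_C_density: "integrable lborel rho_C_density"
proof -
  have int: "integrable lborel (\<lambda>x. indicator {0<..} x *\<^sub>R rho_C_density x)"
    using set_integrable_rho_C_density by (simp add: set_integrable_def)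
  \<comment> \<open>As \<open>0 / 0 = 0\<close>, the density is the sum of its two open halves at the origin as well.\<close>
  have "rho_C_density 0 = 0" by (simp add: rho_C_density_def sinh_kernel_def)
  then have "(\<lambda>x. indicator {0<..} x *\<^sub>R rho_C_density x + indicator {0<..} (0 + - 1 * x) *\<^sub>R rho_C_density (0 + - 1 * x)) = rho_C_density"
    by (auto simp: rho_C_density_even fun_eq_iff not_less split: split_indicator)
  moreover have "integrable lborel (\<lambda>x. indicator {0<..} x *\<^sub>R rho_C_density x
      + indicator {0<..} (0 + - 1 * x) *\<^sub>R rho_C_density (0 + - 1 * x))"
    by (intro Bochner_Integration.integrable_add int lborel_integrable_real_affine[OF int]) auto
  ultimately show ?thesis by simp
qed

lemma finite_borel_measure_rho_C: "finite_borel_measure rho_C"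
proof (intro finite_borel_measure.intro finite_borel_measure_axioms.intro finite_measureI)
  have "emeasure rho_C (space rho_C) = ennreal (integral\<^sup>L lborel rho_C_density)"
    using nn_integral_eq_integral[OF integrable_rho_C_density] rho_C_density_nonneg
    by (simp add: rho_C_def emeasure_density)
  then show "emeasure rho_C (space rho_C) \<noteq> \<infinity>" by simp
qed (simp add: rho_C_def)

lemma integral_rho_C:
  fixes g :: "real \<Rightarrow> complex"
  assumes [measurable]: "g \<in> borel_measurable borel" and bound: "\<And>x. norm (g x) \<le> B"
  shows "(LINT x|rho_C. g x) = (LINT x:{0<..}|lborel. of_real (rho_C_density x) * (g x + g (- x)))"
proof -
  have "integrable lborel (\<lambda>x. rho_C_density x *\<^sub>R g x)"
  proof (rule Bochner_Integration.integrable_bound)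
    show "integrable lborel (\<lambda>x. rho_C_density x * B)" using integrable_rho_C_density by simp
    show "AE x in lborel. norm (rho_C_density x *\<^sub>R g x) \<le> norm (rho_C_density x * B)"
      using bound rho_C_density_nonneg
      by (auto simp: abs_mult intro!: mult_left_mono order_trans[OF bound abs_ge_self])
  qed auto
  then show ?thesis
    by (simp add: rho_C_def integral_density rho_C_density_nonneg integral_lborel_fold rho_C_density_even
        scaleR_conv_of_real ring_distribs)
qed

text \<open>
  Folding the line onto the half-line turns the characteristic function of the even measure into
  the cosine transform computed above.
\<close>

lemma char_rho_C:
  "char rho_C s = of_real (2 * sinh s * arctan (exp (- s)) + pi / 2 * exp (- s) - 1)"
proof -
  have "char rho_C s = (LINT x:{0<..}|lborel. of_real (rho_C_density x) * (iexp (s * x) + iexp (s * - x)))"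
    unfolding char_def by (rule integral_rho_C[where B = 1]) auto
  also have "\<dots> = (LINT x:{0<..}|lborel. complex_of_real (cos (s * x) * (sinh_kernel x * (1 / (1 + x\<^sup>2)))))"
  proof -
    have "iexp (s * x) + iexp (s * - x) = of_real (2 * cos (s * x))" for x
      by (auto simp: complex_eq_iff Re_exp Im_exp)
    then have "of_real (rho_C_density x) * (iexp (s * x) + iexp (s * - x))
        = complex_of_real (cos (s * x) * (2 * rho_C_density x))" for x
      by (simp only: of_real_mult[symmetric]) (simp add: mult_ac)
    then show ?thesis by (simp only: rho_C_density_double)
  qed
  finally show ?thesis
    unfolding set_integral_complex_of_real cos_transform_sinh_kernel_cauchy .
qed

text \<open>
  Adding the values of the Nevanlinna kernel at \<open>x\<close> and \<open>- x\<close> gives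
  \<open>2 i w (1 + x\<^sup>2) / (w\<^sup>2 + x\<^sup>2)\<close>; the density cancels the factor \<open>1 + x\<^sup>2\<close>, and what remains is the
  Poisson formula at \<open>s = 0\<close>.
\<close>

lemma nevanlinna_kernel_integral_rho_C:
  assumes w: "w > 0"
  shows "(LINT x|rho_C. (\<i> * of_real w * of_real x - 1) / (\<i> * of_real w + of_real x))
    = \<i> * (of_real w * nielsen_beta (of_real (w / 2)) - 1)"
proof -
  let ?K = "\<lambda>x. (\<i> * of_real w * of_real x - 1) / (\<i> * of_real w + of_real x)"
  have sum: "of_real (rho_C_density x) * (?K x + ?K (- x)) = \<i> * of_real (cos (0 * x) * (sinh_kernel x * (w / (w\<^sup>2 + x\<^sup>2))))" for x
  proof -
    have nz: "\<i> * of_real w + of_real x \<noteq> 0" "\<i> * of_real w - of_real x \<noteq> 0" "w\<^sup>2 + x\<^sup>2 \<noteq> 0" "1 + x\<^sup>2 \<noteq> 0"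
      using w by (auto simp: complex_eq_iff sum_power2_eq_zero_iff add_nonneg_eq_0_iff)
    have "(\<i> * of_real w + of_real x) * (\<i> * of_real w - of_real x) = - of_real (w\<^sup>2 + x\<^sup>2)"
      by (simp add: algebra_simps power2_eq_square)
    have "(\<i> * of_real w * of_real x - 1) * (\<i> * of_real w - of_real x)
        + (- (\<i> * of_real w * of_real x) - 1) * (\<i> * of_real w + of_real x) = - (\<i> * of_real (2 * (1 + x\<^sup>2) * w))"
      by (simp add: algebra_simps power2_eq_square)
    have "?K x + ?K (- x) = ((\<i> * of_real w * of_real x - 1) * (\<i> * of_real w - of_real x)
        + (- (\<i> * of_real w * of_real x) - 1) * (\<i> * of_real w + of_real x)) / ((\<i> * of_real w + of_real x) * (\<i> * of_real w - of_real x))"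
      using nz by (simp add: add_frac_eq)
    also have "\<dots> = \<i> * of_real (2 * (1 + x\<^sup>2) * (w / (w\<^sup>2 + x\<^sup>2)))"
      unfolding \<open>_ * _ = - of_real (w\<^sup>2 + x\<^sup>2)\<close> \<open>_ + _ = - (\<i> * _)\<close> minus_divide_divide by simp
    finally have "?K x + ?K (- x) = \<i> * of_real (2 * (1 + x\<^sup>2) * (w / (w\<^sup>2 + x\<^sup>2)))" .
    moreover have "rho_C_density x * (2 * (1 + x\<^sup>2) * (w / (w\<^sup>2 + x\<^sup>2))) = sinh_kernel x * (w / (w\<^sup>2 + x\<^sup>2))"
    proof -
      have "rho_C_density x * (2 * (1 + x\<^sup>2) * (w / (w\<^sup>2 + x\<^sup>2))) = (2 * rho_C_density x) * ((1 + x\<^sup>2) * (w / (w\<^sup>2 + x\<^sup>2)))"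
        by (simp only: mult_ac)
      also have "\<dots> = sinh_kernel x * (w / (w\<^sup>2 + x\<^sup>2))"
        unfolding rho_C_density_double using nz(4) by simp
      finally show ?thesis .
    qed
    moreover have "of_real a * (\<i> * of_real b) = \<i> * of_real (a * b)" for a b
      by simp
    ultimately show ?thesis by (simp only: mult_zero_left cos_zero mult_1)
  qed
  have "(LINT x|rho_C. ?K x) = (LINT x:{0<..}|lborel. of_real (rho_C_density x) * (?K x + ?K (- x)))"
  proof (rule integral_rho_C)
    fix x
    \<comment> \<open>Numerator and denominator are compared through \<open>w \<le> |i w + x|\<close> and \<open>|x| \<le> |i w + x|\<close>.\<close>
    have "norm (?K x) \<le> w + 1 / w"
    proof -
      have le: "w \<le> norm (\<i> * of_real w + of_real x)" "\<bar>x\<bar> \<le> norm (\<i> * of_real w + of_real x)"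
        using abs_Im_le_cmod[of "\<i> * of_real w + of_real x"] abs_Re_le_cmod[of "\<i> * of_real w + of_real x"] w by auto
      have "norm (\<i> * of_real w * of_real x - 1) \<le> w * \<bar>x\<bar> + 1"
        using norm_triangle_ineq4[of "\<i> * of_real w * of_real x" 1] w by (simp add: norm_mult)
      also have "\<dots> \<le> w * norm (\<i> * of_real w + of_real x) + 1 / w * norm (\<i> * of_real w + of_real x)"
        using le w by (intro add_mono mult_left_mono) (auto simp: field_simps)
      finally show ?thesis
        using le(1) w by (simp add: norm_divide divide_le_eq ring_distribs)
    qed
    then show "norm (?K x) \<le> w + 1 / w" .
  qed auto
  also have "\<dots> = \<i> * of_real (LINT x:{0<..}|lborel. cos (0 * x) * (sinh_kernel x * (w / (w\<^sup>2 + x\<^sup>2))))"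
    unfolding sum set_integral_complex_of_real[symmetric] by (rule set_integral_mult_right)
  also have "(LINT x:{0<..}|lborel. cos (0 * x) * (sinh_kernel x * (w / (w\<^sup>2 + x\<^sup>2))))
      = (LINT u:{0<..}|lborel. exp (- (w * u)) * (1 / (cosh u)\<^sup>2))"
  proof -
    have "exp (- (w * u)) * (1 / (cosh (0 + u))\<^sup>2 + 1 / (cosh (0 - u))\<^sup>2) = 2 * (exp (- (w * u)) * (1 / (cosh u)\<^sup>2))" for u
      by simp
    then show ?thesis
      unfolding cos_transform_sinh_kernel_poisson[OF w] by (simp only: set_integral_mult_right)
  qed
  also have "of_real \<dots> = of_real w * nielsen_beta (of_real (w / 2)) - 1"
    unfolding mult_nielsen_beta_half[OF w] by simp
  finally show ?thesis .
qed

theorem proposition3: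
  fixes V F :: "complex \<Rightarrow> complex"
  assumes "\<And>w::real. w > 0 \<Longrightarrow> V (\<i> * of_real w) = - F (\<i> * of_real w)"
    and "\<And>w::real. w > 0 \<Longrightarrow>
           V (\<i> * of_real w) = \<i> * (1 - of_real w * nielsen_beta (of_real (w / 2)))"
  shows "\<exists>\<rho>. free_characteristics F 0 0 \<rho> \<and>
    measure \<rho> UNIV = pi / 2 - 1 \<and>
    (\<forall>s::real.
       char \<rho> s = of_real (2 * sinh s * arctan (exp (- s)) + pi / 2 * exp (- s) - 1) \<and>
       set_integrable lborel {0<..}
         (\<lambda>x::real. cos (s * x) * (x / ((1 + x\<^sup>2) * sinh (pi / 2 * x)))) \<and>
       2 * sinh s * arctan (exp (- s)) + pi / 2 * exp (- s) - 1 =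
         (LINT x:{0<..}|lborel. cos (s * x) * (x / ((1 + x\<^sup>2) * sinh (pi / 2 * x)))))"
proof (intro exI conjI allI)
  interpret finite_borel_measure rho_C by (rule finite_borel_measure_rho_C)
  have kernel: "x / ((1 + x\<^sup>2) * sinh (pi / 2 * x)) = sinh_kernel x * (1 / (1 + x\<^sup>2))" for x :: real
    by (simp add: sinh_kernel_def mult.commute)
  have "free_id_representation F 0 0 rho_C"
    unfolding free_id_representation_def
  proof (intro conjI allI impI)
    fix w :: real assume w: "w > 0"
    have "F (\<i> * of_real w) = - V (\<i> * of_real w)"
      using assms(1)[OF w] by simp
    also have "\<dots> = \<i> * (of_real w * nielsen_beta (of_real (w / 2)) - 1)"
      unfolding assms(2)[OF w] by (simp add: algebra_simps)
    finally show "F (\<i> * of_real w) = of_real 0 + \<i> * of_real 0 * of_real w +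
        (LINT x|rho_C. (\<i> * of_real w * of_real x - 1) / (\<i> * of_real w + of_real x))"
      unfolding nevanlinna_kernel_integral_rho_C[OF w] by simp
  qed (simp_all add: finite_measure_axioms)
  then show "free_characteristics F 0 0 rho_C"
    unfolding free_characteristics_def using free_id_representation_unique by blast
  have "complex_of_real (measure rho_C UNIV) = of_real (pi / 2 - 1)"
    using char_rho_C[of 0] by (simp add: char_at_zero)
  then show "measure rho_C UNIV = pi / 2 - 1" by (simp only: of_real_eq_iff)
  fix s :: real
  show "char rho_C s = of_real (2 * sinh s * arctan (exp (- s)) + pi / 2 * exp (- s) - 1)"
    by (rule char_rho_C)
  show "set_integrable lborel {0<..} (\<lambda>x::real. cos (s * x) * (x / ((1 + x\<^sup>2) * sinh (pi / 2 * x))))"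
  proof (rule set_integrable_bound[OF set_integrable_mult_right[of 2, OF set_integrable_rho_C_density]])
    show "set_borel_measurable lborel {0<..} (\<lambda>x. cos (s * x) * (x / ((1 + x\<^sup>2) * sinh (pi / 2 * x))))"
      unfolding kernel by (simp add: set_borel_measurable_def)
    have "norm (cos (s * x) * (x / ((1 + x\<^sup>2) * sinh (pi / 2 * x)))) \<le> norm (2 * rho_C_density x)" for x
      unfolding kernel rho_C_density_double[symmetric]
      using mult_right_mono[OF abs_cos_le_one[of "s * x"], of "2 * rho_C_density x"] rho_C_density_nonneg[of x]
      by (simp add: abs_mult)
    then show "AE x in lborel. x \<in> {0<..} \<longrightarrow>
        norm (cos (s * x) * (x / ((1 + x\<^sup>2) * sinh (pi / 2 * x)))) \<le> norm (2 * rho_C_density x)" by (intro AE_I2 impI)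
  qed
  show "2 * sinh s * arctan (exp (- s)) + pi / 2 * exp (- s) - 1 =
      (LINT x:{0<..}|lborel. cos (s * x) * (x / ((1 + x\<^sup>2) * sinh (pi / 2 * x))))"
    unfolding kernel by (rule cos_transform_sinh_kernel_cauchy[symmetric])
qed

end
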